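(* There is an absolute constant $c>0$ such that every finite union $S$ of full chords of the unit disk $B=B(0,1)\subset\mathbb R^2$ satisfies, for all sufficiently large $L(S)$ (i.e. whenever $L(S)\ge L_0$ for some absolute constant $L_0$), $$\operatorname{disc}_B(S)\ge c\log L(S).$$
   Context: $B=B(0,1)$ is the closed unit disk, $|B|=\pi$ is its area, and $\mathcal H^1$ is one-dimensional Hausdorff measure. A full chord of $B$ is a set of the form $g\cap B$, where $g$ is a line meeting $B$. For $S\subset B$ a finite union of full chords (counted without multiplicity), write $L(S)=\mathcal H^1(S)$. For a line $\ell$, $\#(\ell\cap S)$ denotes the number of transverse intersections of $\ell$ with $S$, counted with multiplicity over the chords. Let $\mathcal L$ be the space of lines in the plane, with its usual motion-invariant measure. The Buffon discrepancy is $$\operatorname{disc}_B(S):=\operatorname*{ess\,sup}_{\ell\in\mathcal L}\left|\#(\ell\cap S)-\frac{2L(S)}{\pi|B|}\,\mathcal H^1(\ell\cap B)\right|;$$ the essential supremum ignores the exceptional null set of lines that pass through an endpoint of a chord or contain a subarc of $S$. *)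

theory Defs
  imports "HOL-Analysis.Analysis" "HOL-Probability.Essential_Supremum"
begin

section \<open>One-dimensional Hausdorff measure\<close>

text \<open>The library's \<^term>\<open>diameter\<close> takes a default value on unbounded sets, so the covers are
  required to consist of bounded sets; sets of infinite diameter are never \<open>\<delta>\<close>-small anyway.\<close>

definition delta_covers :: "real \<Rightarrow> 'a::metric_space set \<Rightarrow> (nat \<Rightarrow> 'a set) set" where
  "delta_covers \<delta> A = {U. A \<subseteq> (\<Union>i. U i) \<and> (\<forall>i. bounded (U i) \<and> diameter (U i) \<le> \<delta>)}"

definition hausdorff1 :: "'a::metric_space set \<Rightarrow> ennreal" where
  "hausdorff1 A = (SUP \<delta>\<in>{0<..}. INF U\<in>delta_covers \<delta> A. \<Sum>i. ennreal (diameter (U i)))"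

definition len :: "'a::metric_space set \<Rightarrow> real" where
  "len A = enn2real (hausdorff1 A)"


section \<open>Lines and full chords\<close>

type_synonym plane = "real^2"

abbreviation unit_disk :: "plane set" where
  "unit_disk \<equiv> cball 0 1"

definition is_line :: "plane set \<Rightarrow> bool" where
  "is_line g \<longleftrightarrow> affine g \<and> aff_dim g = 1"

definition full_chord :: "plane set \<Rightarrow> bool" where
  "full_chord K \<longleftrightarrow> (\<exists>g. is_line g \<and> g \<inter> unit_disk \<noteq> {} \<and> K = g \<inter> unit_disk)"


section \<open>The motion-invariant measure on lines\<close>

text \<open>The usual invariant measure is \<open>dp d\<theta>\<close>, where the line has signed distance \<open>p\<close> from the
  origin and unit normal \<open>(cos \<theta>, sin \<theta>)\<close> with \<open>0 \<le> \<theta> < \<pi>\<close>. Lemmas \<open>inj_on_line_of\<close>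
  and \<open>space_line_measure\<close> show that this parametrises every line exactly once, so that
  \<^const>\<open>embed_measure\<close> just transports the measure.\<close>

definition line_of :: "real \<times> real \<Rightarrow> plane set" where
  "line_of = (\<lambda>(\<theta>, p). {x. cos \<theta> * x$1 + sin \<theta> * x$2 = p})"

definition line_measure :: "plane set measure" where
  "line_measure = embed_measure (restrict_space lborel ({0..<pi} \<times> UNIV)) line_of"

lemma line_of_hyperplane: "line_of (\<theta>, p) = {x. vector [cos \<theta>, sin \<theta>] \<bullet> x = p}"
  by (auto simp: line_of_def inner_vec_def sum_2)

lemma is_line_line_of: "is_line (line_of q)"
proof -
  obtain \<theta> p where q: "q = (\<theta>, p)" by fastforce
  have "(vector [cos \<theta>, sin \<theta>] :: plane) \<noteq> 0"
  proof
    assume "(vector [cos \<theta>, sin \<theta>] :: plane) = 0"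
    then have "cos \<theta> = 0" "sin \<theta> = 0"
      by (auto simp: vec_eq_iff forall_2)
    then show False using sin_cos_squared_add[of \<theta>] by simp
  qed
  then show ?thesis
    by (auto simp: is_line_def q line_of_hyperplane affine_hyperplane aff_dim_hyperplane)
qed

lemma inj_on_line_of: "inj_on line_of ({0..<pi} \<times> UNIV)"
proof (rule inj_onI, clarify)
  fix t p u q
  assume t: "t \<in> {0..<pi}" and u: "u \<in> {0..<pi}" and eq: "line_of (t, p) = line_of (u, q)"
  have on: "cos t * x + sin t * y = p \<longleftrightarrow> cos u * x + sin u * y = q" for x y
  proof -
    have "(vector [x, y] :: plane) \<in> line_of (t, p) \<longleftrightarrow> vector [x, y] \<in> line_of (u, q)"
      using eq by simp
    then show ?thesis by (simp add: line_of_def)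
  qed
  have n: "cos t * cos t + sin t * sin t = 1"
    using sin_cos_squared_add2[of t] by (simp add: power2_eq_square algebra_simps)
  have 1: "cos u * (p * cos t) + sin u * (p * sin t) = q"
  proof (rule iffD1[OF on])
    have "cos t * (p * cos t) + sin t * (p * sin t) = p * (cos t * cos t + sin t * sin t)"
      by (simp add: algebra_simps del: sin_cos_squared_add3)
    then show "cos t * (p * cos t) + sin t * (p * sin t) = p" unfolding n by simp
  qed
  have 2: "cos u * (p * cos t - sin t) + sin u * (p * sin t + cos t) = q"
  proof (rule iffD1[OF on])
    have "cos t * (p * cos t - sin t) + sin t * (p * sin t + cos t)
        = p * (cos t * cos t + sin t * sin t)"
      by (simp add: algebra_simps del: sin_cos_squared_add3)
    then show "cos t * (p * cos t - sin t) + sin t * (p * sin t + cos t) = p" unfolding n by simp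
  qed
  have s0: "sin (u - t) = 0" using 1 2 by (simp add: sin_diff algebra_simps)
  have tu: "t = u"
  proof (rule ccontr)
    assume "t \<noteq> u"
    then have "0 < \<bar>u - t\<bar>" "\<bar>u - t\<bar> < pi" using t u by auto
    then have "sin \<bar>u - t\<bar> > 0" by (rule sin_gt_zero)
    moreover have "\<bar>u - t\<bar> = u - t \<or> \<bar>u - t\<bar> = - (u - t)" by arith
    ultimately show False using s0 sin_minus[of "u - t"] by fastforce
  qed
  have "p = q"
  proof -
    have "p * (cos t * cos t + sin t * sin t) = q" using 1 unfolding tu
      by (simp add: algebra_simps del: sin_cos_squared_add3)
    then show ?thesis unfolding n by simp
  qed
  then show "t = u \<and> p = q" using tu by simp
qed

lemma space_line_measure: "space line_measure = {g. is_line g}"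
proof -
  have sp: "space line_measure = line_of ` ({0..<pi} \<times> UNIV)"
    by (simp add: line_measure_def space_embed_measure space_restrict_space)
  have "g \<in> line_of ` ({0..<pi} \<times> UNIV)" if "is_line g" for g
  proof -
    have aff: "affine hull g = g" using that by (simp add: is_line_def)
    have "aff_dim g = DIM(plane) - 1" using that by (simp add: is_line_def)
    then have "\<exists>a b. a \<noteq> 0 \<and> affine hull g = {x. a \<bullet> x = b}"
      by (rule iffD1[OF aff_dim_eq_hyperplane])
    then obtain a b where a: "a \<noteq> 0" and g: "g = {x. a \<bullet> x = b}"
      unfolding aff by blast
    define r where "r = sqrt ((a$1)\<^sup>2 + (a$2)\<^sup>2)"
    have "(a$1)\<^sup>2 + (a$2)\<^sup>2 \<noteq> 0"
      using a by (auto simp: vec_eq_iff forall_2 sum_power2_eq_zero_iff)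
    then have r: "r > 0" and r2: "r\<^sup>2 = (a$1)\<^sup>2 + (a$2)\<^sup>2"
      by (auto simp: r_def sum_power2_gt_zero_iff sum_power2_eq_zero_iff)
    have "(a$1 / r)\<^sup>2 + (a$2 / r)\<^sup>2 = 1"
      using r by (simp add: power_divide add_divide_distrib[symmetric] flip: r2)
    then obtain s where s: "0 \<le> s" "s < 2 * pi" "a$1 / r = cos s" "a$2 / r = sin s"
      by (rule sincos_total_2pi)
    have as: "a$1 = r * cos s" "a$2 = r * sin s" using s r by (auto simp: field_simps)
    have g': "x \<in> g \<longleftrightarrow> cos s * x$1 + sin s * x$2 = b / r" for x
    proof -
      have "a \<bullet> x = (cos s * x$1 + sin s * x$2) * r"
        by (simp add: inner_vec_def sum_2 as algebra_simps)
      then show ?thesis using r by (simp add: g nonzero_eq_divide_eq)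
    qed
    show ?thesis
    proof (cases "s < pi")
      case True
      have "g = line_of (s, b / r)" unfolding line_of_def by (simp add: set_eq_iff g')
      then show ?thesis using True s by auto
    next
      case False
      have "cos (s - pi) = - cos s" "sin (s - pi) = - sin s" by (auto simp: cos_diff sin_diff)
      then have "x \<in> g \<longleftrightarrow> x \<in> line_of (s - pi, - (b / r))" for x
        unfolding g' line_of_def by simp linarith
      then have "g = line_of (s - pi, - (b / r))" by blast
      then show ?thesis using False s by auto
    qed
  qed
  then show ?thesis using sp is_line_line_of by auto
qed


section \<open>The Buffon discrepancy\<close>

text \<open>The union \<open>S = \<Union>C\<close> is represented by its finite set \<open>C\<close> of chords, which is
  what makes ``with multiplicity over the chords'' meaningful: a point of \<open>l\<close> lying on several
  chords is counted once for each of them. Two distinct lines that meet do so transversally.\<close>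

definition crosses :: "plane set \<Rightarrow> plane set \<Rightarrow> bool" where
  "crosses l K \<longleftrightarrow> (\<exists>g. is_line g \<and> K = g \<inter> unit_disk \<and> g \<noteq> l) \<and> l \<inter> K \<noteq> {}"

definition crossing_number :: "plane set \<Rightarrow> plane set set \<Rightarrow> nat" where
  "crossing_number l C = card {K \<in> C. crosses l K}"

text \<open>\<^const>\<open>esssup\<close> is the ordinary essential supremum here, because the function below is
  Borel in the parameters \<open>(\<theta>, p)\<close> whenever \<open>C\<close> is a finite set of full chords.\<close>

definition buffon_disc :: "plane set set \<Rightarrow> ereal" where
  "buffon_disc C = esssup line_measure (\<lambda>l. ereal \<bar>real (crossing_number l C)
      - 2 * len (\<Union>C) / (pi * measure lborel unit_disk) * len (l \<inter> unit_disk)\<bar>)"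

end

theory Submission
  imports Defs
begin

text \<open>
  A chord joins two points of the unit circle, and a line crosses it exactly when the two points where
  the line leaves the disk separate its ends on the circle. Writing a line through the boundary angles
  \<open>x \<in> (0, 1)\<close> and \<open>y \<in> (3, 4)\<close>, the difference
  \<open>F x y = \<mu> * 2 * sin ((y - x) / 2) - (number of chords crossed)\<close> is therefore a function of two variables
  whose second mixed difference over a rectangle is a smooth positive main term, comparable to
  \<open>\<mu>\<close> times the area (\<open>mixed_diff_chord_length_bounds\<close>), minus twice the number of chords with one end in
  each side of the rectangle (\<open>mixed_diff_count_separated\<close>). So the question is the classical one on the
  discrepancy of a finite point set with respect to rectangles in the plane, where a logarithm is forced.

  The logarithm comes from Halasz's Riesz product argument, carried out here with finite sums over a
  dyadic grid of \<open>2 ^ (n + 1)\<close> by \<open>2 ^ (n + 1)\<close> points, where \<open>2 ^ n\<close> is comparable to \<open>\<mu>\<close>. For each of the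
  \<open>n + 1\<close> shapes \<open>k\<close> of a dyadic cell of fixed area, the function \<open>r_fun n P k\<close> is a product of two
  Rademacher functions on the cells that contain no point and vanishes on the others. At most half
  of the cells are occupied, so the correlation of each shape with \<open>F\<close> has the same lower bound
  (\<open>first_order\<close>). The product of the factors \<open>1 + \<gamma> * r_fun n P k\<close> is nonnegative with mean one, hence
  correlates with \<open>F\<close> by at most the supremum of \<open>\<bar>F\<bar>\<close>. Its terms of order one add up to
  \<open>\<gamma> * (n + 1)\<close> times a constant, while those of higher order decay geometrically in the distance between the
  coarsest and the finest shape involved (\<open>second_order\<close>) and contribute only \<open>\<gamma>\<^sup>2 * (n + 1)\<close> times a
  constant. A small fixed \<open>\<gamma>\<close> leaves a supremum of order \<open>n\<close> (\<open>sup_norm_lower_bound\<close>), that is \<open>ln \<mu>\<close>.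

  The argument gives \<open>ln \<mu>\<close> for every large coefficient \<open>\<mu>\<close> in front of the length of the cut-out
  segment; the coefficient of the Buffon discrepancy is a constant multiple of \<open>L(S)\<close>. The essential supremum
  controls each line between the two arcs that misses the chord ends, because there the crossing number is locally
  constant and the length continuous (\<open>buffon_disc_pointwise\<close>).
\<close>

section \<open>Mixed differences and Rademacher functions\<close>

definition mixed_diff :: "('a \<Rightarrow> 'b \<Rightarrow> real) \<Rightarrow> 'a \<Rightarrow> 'a \<Rightarrow> 'b \<Rightarrow> 'b \<Rightarrow> real" where
  "mixed_diff T x x' y y' = T x y - T x' y - T x y' + T x' y'"

text \<open>The sign given by the binary digit of \<open>i\<close> at position \<open>k\<close>: a Rademacher function on the integers.\<close>

definition rad :: "nat \<Rightarrow> nat \<Rightarrow> real" where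
  "rad k i = (-1) ^ (i div 2 ^ k)"

lemma abs_rad [simp]: "\<bar>rad k i\<bar> = 1"
  by (simp add: rad_def power_abs)

lemma sum_lessThan_add:
  fixes f :: "nat \<Rightarrow> real"
  shows "(\<Sum>i<m + n. f i) = (\<Sum>i<m. f i) + (\<Sum>i<n. f (m + i))"
  by (induction n) auto

text \<open>A block of length \<open>2 ^ Suc k\<close> is split by digit \<open>k\<close> into two halves with opposite signs, so pairing points at
  distance \<open>2 ^ k\<close> turns the sum into one of differences of \<open>g\<close>.\<close>

lemma sum_rad_blocks:
  fixes g c :: "nat \<Rightarrow> real"
  shows "(\<Sum>i<m * 2 ^ Suc k. g i * c (i div 2 ^ Suc k) * rad k i)
    = (\<Sum>p<m. c p * (\<Sum>i<2 ^ k. g (p * 2 ^ Suc k + i) - g (p * 2 ^ Suc k + 2 ^ k + i)))"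
proof (induction m)
  case 0
  then show ?case by simp
next
  case (Suc m)
  let ?w = "2 ^ k :: nat"
  have block_low: "(m * 2 ^ Suc k + i) div 2 ^ Suc k = m" "(m * 2 ^ Suc k + i) div ?w = 2 * m"
    if "i < ?w" for i
    using that by (auto intro!: div_nat_eqI)
  have block_high: "(m * 2 ^ Suc k + (?w + i)) div 2 ^ Suc k = m"
      "(m * 2 ^ Suc k + (?w + i)) div ?w = Suc (2 * m)"
    if "i < ?w" for i
    using that by (auto intro!: div_nat_eqI)
  have low: "g (m * 2 ^ Suc k + i) * c ((m * 2 ^ Suc k + i) div 2 ^ Suc k) * rad k (m * 2 ^ Suc k + i)
      = c m * g (m * 2 ^ Suc k + i)" if "i < ?w" for i
    unfolding rad_def block_low[OF that] by simp
  have high: "g (m * 2 ^ Suc k + (?w + i)) * c ((m * 2 ^ Suc k + (?w + i)) div 2 ^ Suc k)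
        * rad k (m * 2 ^ Suc k + (?w + i))
      = - (c m * g (m * 2 ^ Suc k + ?w + i))" if "i < ?w" for i
    unfolding rad_def block_high[OF that] by (simp add: add.assoc)
  have len: "Suc m * 2 ^ Suc k = m * 2 ^ Suc k + (?w + ?w)" by simp
  have block: "(\<Sum>i<?w. c m * g (m * 2 ^ Suc k + i)) + (\<Sum>i<?w. - (c m * g (m * 2 ^ Suc k + ?w + i)))
      = c m * (\<Sum>i<?w. g (m * 2 ^ Suc k + i) - g (m * 2 ^ Suc k + ?w + i))"
    by (simp add: sum_subtractf sum_negf sum_distrib_left right_diff_distrib)
  show ?case
    unfolding len sum_lessThan_add Suc.IH sum.lessThan_Suc block[symmetric]
    by (intro arg_cong2[where f = "(+)"] sum.cong refl low high) simp_all
qed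

text \<open>The one-dimensional pairing in each variable in turn produces mixed differences of \<open>T\<close>.\<close>

lemma sum_rad_blocks2:
  fixes T :: "nat \<Rightarrow> nat \<Rightarrow> real"
  shows "(\<Sum>i<m * 2 ^ Suc k. \<Sum>j<l * 2 ^ Suc h.
            T i j * (c (i div 2 ^ Suc k) (j div 2 ^ Suc h) * rad k i * rad h j))
    = (\<Sum>p<m. \<Sum>q<l. c p q * (\<Sum>i<2 ^ k. \<Sum>j<2 ^ h.
         mixed_diff T (p * 2 ^ Suc k + i) (p * 2 ^ Suc k + 2 ^ k + i)
                      (q * 2 ^ Suc h + j) (q * 2 ^ Suc h + 2 ^ h + j)))"
proof -
  define D where "D i q = (\<Sum>j<2 ^ h. T i (q * 2 ^ Suc h + j) - T i (q * 2 ^ Suc h + 2 ^ h + j))" for i q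
  have D_diff: "D x q - D y q = (\<Sum>j<2 ^ h. mixed_diff T x y (q * 2 ^ Suc h + j) (q * 2 ^ Suc h + 2 ^ h + j))"
    for x y q
    unfolding D_def mixed_diff_def sum_subtractf[symmetric]
    by (intro sum.cong refl) simp
  have "(\<Sum>j<l * 2 ^ Suc h. T i j * (c (i div 2 ^ Suc k) (j div 2 ^ Suc h) * rad k i * rad h j))
      = (\<Sum>q<l. D i q * c (i div 2 ^ Suc k) q * rad k i)" for i
  proof -
    have "(\<Sum>j<l * 2 ^ Suc h. T i j * (c (i div 2 ^ Suc k) (j div 2 ^ Suc h) * rad k i * rad h j))
        = rad k i * (\<Sum>j<l * 2 ^ Suc h. T i j * c (i div 2 ^ Suc k) (j div 2 ^ Suc h) * rad h j)"
      by (simp add: sum_distrib_left mult_ac del: power_Suc)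
    also have "\<dots> = rad k i * (\<Sum>q<l. c (i div 2 ^ Suc k) q * D i q)"
      by (simp only: sum_rad_blocks D_def)
    finally show ?thesis by (simp add: sum_distrib_left mult_ac del: power_Suc)
  qed
  then have "(\<Sum>i<m * 2 ^ Suc k. \<Sum>j<l * 2 ^ Suc h.
            T i j * (c (i div 2 ^ Suc k) (j div 2 ^ Suc h) * rad k i * rad h j))
      = (\<Sum>i<m * 2 ^ Suc k. \<Sum>q<l. D i q * c (i div 2 ^ Suc k) q * rad k i)"
    by (simp only:)
  also have "\<dots> = (\<Sum>q<l. \<Sum>i<m * 2 ^ Suc k. D i q * c (i div 2 ^ Suc k) q * rad k i)"
    by (rule sum.swap)
  also have "\<dots> = (\<Sum>q<l. \<Sum>p<m. c p q *
      (\<Sum>i<2 ^ k. D (p * 2 ^ Suc k + i) q - D (p * 2 ^ Suc k + 2 ^ k + i) q))"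
    by (simp only: sum_rad_blocks[where c = "\<lambda>p. c p _"])
  also have "\<dots> = (\<Sum>p<m. \<Sum>q<l. c p q *
      (\<Sum>i<2 ^ k. D (p * 2 ^ Suc k + i) q - D (p * 2 ^ Suc k + 2 ^ k + i) q))"
    by (rule sum.swap)
  finally show ?thesis unfolding D_diff .
qed

lemma prod_one_plus_expand_upper:
  fixes g :: "nat \<Rightarrow> real"
  shows "(\<Prod>k<m. 1 + g k) = 1 + (\<Sum>b<m. g b * (\<Prod>k<b. 1 + g k))"
  by (induction m) (auto simp: algebra_simps)

lemma prod_one_plus_expand_lower:
  fixes g :: "nat \<Rightarrow> real"
  shows "(\<Prod>k<m. 1 + g k) = 1 + (\<Sum>a<m. g a * (\<Prod>k\<in>{a<..<m}. 1 + g k))"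
proof (induction m)
  case (Suc m)
  have "{a<..<Suc m} = insert m {a<..<m}" if "a < m" for a using that by auto
  then have "(\<Sum>a<m. g a * (\<Prod>k\<in>{a<..<Suc m}. 1 + g k))
      = (\<Sum>a<m. g a * (\<Prod>k\<in>{a<..<m}. 1 + g k)) * (1 + g m)"
    by (simp add: sum_distrib_left mult_ac)
  moreover have "{m<..<Suc m} = {}" by auto
  ultimately show ?case using Suc by (simp add: algebra_simps)
qed simp

text \<open>The terms of order at least two are grouped by their smallest index \<open>a\<close> and their largest index \<open>b\<close>. For the Riesz
  product only these two matter for the size of a correlation, so the factors in between are left multiplied together.\<close>

lemma prod_one_plus_expand:
  fixes g :: "nat \<Rightarrow> real"
  shows "(\<Prod>k<m. 1 + g k) = 1 + (\<Sum>b<m. g b)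
      + (\<Sum>b<m. \<Sum>a<b. g a * g b * (\<Prod>k\<in>{a<..<b}. 1 + g k))"
proof -
  have "(\<Prod>k<m. 1 + g k) = 1 + (\<Sum>b<m. g b * (1 + (\<Sum>a<b. g a * (\<Prod>k\<in>{a<..<b}. 1 + g k))))"
    by (subst prod_one_plus_expand_upper) (simp only: prod_one_plus_expand_lower)
  then show ?thesis
    by (simp add: distrib_left sum.distrib sum_distrib_left mult_ac)
qed

section \<open>Riesz products on a dyadic grid\<close>

text \<open>Division by \<open>2 ^ k\<close> labels the dyadic intervals of length \<open>2 ^ k\<close>; the cell meant here is the dyadic rectangle of
  size \<open>2 ^ k\<close> by \<open>2 ^ h\<close> around \<open>(i, j)\<close>.\<close>

definition free_cell :: "(nat \<times> nat) set \<Rightarrow> nat \<Rightarrow> nat \<Rightarrow> nat \<Rightarrow> nat \<Rightarrow> bool" where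
  "free_cell P k h i j \<longleftrightarrow> (\<forall>(u, v)\<in>P. \<not> (u div 2 ^ k = i div 2 ^ k \<and> v div 2 ^ h = j div 2 ^ h))"

text \<open>Halasz's auxiliary functions. The cells of shape \<open>k\<close> all have area \<open>4 * 2 ^ n\<close>, whatever \<open>k\<close> is. Occupied cells
  get the value zero, so that in correlations with these functions only rectangles without points are seen.\<close>

definition r_fun :: "nat \<Rightarrow> (nat \<times> nat) set \<Rightarrow> nat \<Rightarrow> nat \<Rightarrow> nat \<Rightarrow> real" where
  "r_fun n P k i j = of_bool (free_cell P (Suc k) (Suc (n - k)) i j) * rad k i * rad (n - k) j"

lemma abs_r_fun_le: "\<bar>r_fun n P k i j\<bar> \<le> 1"
  by (simp add: r_fun_def abs_mult)

lemma div_power2_mono: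
  fixes i i' :: nat
  assumes "i div 2 ^ a = i' div 2 ^ a" "a \<le> b"
  shows "i div 2 ^ b = i' div 2 ^ b"
proof -
  have "(2::nat) ^ b = 2 ^ a * 2 ^ (b - a)" using assms(2) by (simp flip: power_add)
  then show ?thesis using assms(1) by (simp add: div_mult2_eq)
qed

lemma free_cell_cong:
  assumes "i div 2 ^ k' = i' div 2 ^ k'" "j div 2 ^ h' = j' div 2 ^ h'" "k' \<le> k" "h' \<le> h"
  shows "free_cell P k h i j = free_cell P k h i' j'"
  using div_power2_mono[OF assms(1,3)] div_power2_mono[OF assms(2,4)] by (simp add: free_cell_def)

lemma free_cell_mono:
  assumes "free_cell P k h i j" "k' \<le> k" "h' \<le> h"
  shows "free_cell P k' h' i j"
  using assms(1) div_power2_mono[OF _ assms(2)] div_power2_mono[OF _ assms(3)]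
  unfolding free_cell_def by blast

lemma rad_cong:
  assumes "i div 2 ^ k' = i' div 2 ^ k'" "k' \<le> k"
  shows "rad k i = rad k i'"
  using div_power2_mono[OF assms] by (simp add: rad_def)

lemma card_filter_compl:
  assumes "finite S"
  shows "card S = card {x \<in> S. Q x} + card {x \<in> S. \<not> Q x}"
proof -
  have "card S = card ({x \<in> S. Q x} \<union> {x \<in> S. \<not> Q x})"
    by (rule arg_cong[where f = card]) blast
  also have "\<dots> = card {x \<in> S. Q x} + card {x \<in> S. \<not> Q x}"
    using assms by (intro card_Un_disjoint) auto
  finally show ?thesis .
qed

text \<open>\<open>T\<close> plays the role of a discrepancy: over a rectangle that contains no point of \<open>P\<close> its mixed difference is the measure
  of the rectangle, which has density between \<open>A\<close> and \<open>B\<close>. There are so few points that they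
  occupy at most half of the \<open>2 ^ n\<close> cells of any shape.\<close>

locale near_uniform_grid =
  fixes T :: "nat \<Rightarrow> nat \<Rightarrow> real" and P :: "(nat \<times> nat) set" and n :: nat and A B :: real
  assumes finite_P: "finite P" and card_P: "2 * card P \<le> 2 ^ n"
    and A_nonneg: "0 \<le> A" and B_nonneg: "0 \<le> B"
    and mixed_lower: "\<And>i i' j j'. \<lbrakk>i < i'; i' < 2 ^ Suc n; j < j'; j' < 2 ^ Suc n;
        P \<inter> {i..<i'} \<times> {j..<j'} = {}\<rbrakk>
      \<Longrightarrow> A * real (i' - i) * real (j' - j) \<le> mixed_diff T i i' j j'"
    and mixed_upper: "\<And>i i' j j'. \<lbrakk>i < i'; i' < 2 ^ Suc n; j < j'; j' < 2 ^ Suc n;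
        P \<inter> {i..<i'} \<times> {j..<j'} = {}\<rbrakk>
      \<Longrightarrow> mixed_diff T i i' j j' \<le> B * real (i' - i) * real (j' - j)"
begin

abbreviation N :: nat where "N \<equiv> 2 ^ Suc n"

lemma index_bound:
  assumes "p < 2 ^ (n - k)" "k \<le> n" "i < (2::nat) ^ k"
  shows "p * 2 ^ Suc k + 2 ^ k + i < 2 ^ Suc n"
proof -
  have "Suc p * 2 ^ Suc k \<le> 2 ^ (n - k) * 2 ^ Suc k"
    using assms(1) by (intro mult_right_mono) auto
  also have "\<dots> = 2 ^ Suc n" using assms(2) by (simp flip: power_add)
  finally show ?thesis using assms(3) by simp
qed

text \<open>A point in the left half of a cell and its partner in the right half, in both coordinates, are the corners of a
  rectangle inside the cell; if the cell is free, so is the rectangle.\<close>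

lemma mixed_in_free_cell:
  assumes "k \<le> n" "h \<le> n" "p < 2 ^ (n - k)" "q < 2 ^ (n - h)" "i < 2 ^ k" "j < 2 ^ h"
    and free: "free_cell P (Suc k) (Suc h) (p * 2 ^ Suc k) (q * 2 ^ Suc h)"
  shows "A * 2 ^ k * 2 ^ h \<le> mixed_diff T (p * 2 ^ Suc k + i) (p * 2 ^ Suc k + 2 ^ k + i)
                      (q * 2 ^ Suc h + j) (q * 2 ^ Suc h + 2 ^ h + j)" (is "_ \<le> ?D")
    and "mixed_diff T (p * 2 ^ Suc k + i) (p * 2 ^ Suc k + 2 ^ k + i)
                      (q * 2 ^ Suc h + j) (q * 2 ^ Suc h + 2 ^ h + j) \<le> B * 2 ^ k * 2 ^ h"
proof -
  have div: "u div 2 ^ Suc k = p" if "u \<in> {p * 2 ^ Suc k + i..<p * 2 ^ Suc k + 2 ^ k + i}" "i < 2 ^ k"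
    for u k p i :: nat
    using that by (intro div_nat_eqI) (auto simp: algebra_simps)
  have "P \<inter> {p * 2 ^ Suc k + i..<p * 2 ^ Suc k + 2 ^ k + i}
      \<times> {q * 2 ^ Suc h + j..<q * 2 ^ Suc h + 2 ^ h + j} = {}"
  proof (rule equals0I)
    fix z assume "z \<in> P \<inter> {p * 2 ^ Suc k + i..<p * 2 ^ Suc k + 2 ^ k + i}
      \<times> {q * 2 ^ Suc h + j..<q * 2 ^ Suc h + 2 ^ h + j}"
    then obtain u v where uv: "(u, v) \<in> P" "u \<in> {p * 2 ^ Suc k + i..<p * 2 ^ Suc k + 2 ^ k + i}"
        "v \<in> {q * 2 ^ Suc h + j..<q * 2 ^ Suc h + 2 ^ h + j}"
      by blast
    have "u div 2 ^ Suc k = p * 2 ^ Suc k div 2 ^ Suc k"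
      unfolding div[OF uv(2) assms(5)] by simp
    moreover have "v div 2 ^ Suc h = q * 2 ^ Suc h div 2 ^ Suc h"
      unfolding div[OF uv(3) assms(6)] by simp
    ultimately show False using free uv(1) unfolding free_cell_def by blast
  qed
  note * = mixed_lower[OF _ index_bound[OF assms(3,1,5)] _ index_bound[OF assms(4,2,6)] this]
    mixed_upper[OF _ index_bound[OF assms(3,1,5)] _ index_bound[OF assms(4,2,6)] this]
  show "A * 2 ^ k * 2 ^ h \<le> ?D" "?D \<le> B * 2 ^ k * 2 ^ h"
    using * by (simp_all add: add.commute)
qed

lemma grid_split: "k \<le> n \<Longrightarrow> N = 2 ^ (n - k) * 2 ^ Suc k"
  by (simp flip: power_add)

text \<open>A weight that is constant on the cells can be pulled out of the pairing.\<close>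

lemma sum_blockwise:
  fixes F W :: "nat \<Rightarrow> nat \<Rightarrow> real"
  assumes "k \<le> n" "h \<le> n"
    and W: "\<And>i j i' j'. \<lbrakk>i div 2 ^ Suc k = i' div 2 ^ Suc k; j div 2 ^ Suc h = j' div 2 ^ Suc h\<rbrakk>
      \<Longrightarrow> W i j = W i' j'"
  shows "(\<Sum>i<N. \<Sum>j<N. F i j * (W i j * rad k i * rad h j))
    = (\<Sum>p<2 ^ (n - k). \<Sum>q<2 ^ (n - h). W (p * 2 ^ Suc k) (q * 2 ^ Suc h) *
        (\<Sum>i<2 ^ k. \<Sum>j<2 ^ h.
         mixed_diff F (p * 2 ^ Suc k + i) (p * 2 ^ Suc k + 2 ^ k + i)
                      (q * 2 ^ Suc h + j) (q * 2 ^ Suc h + 2 ^ h + j)))"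
proof -
  have W_corner: "W i j = W (i div 2 ^ Suc k * 2 ^ Suc k) (j div 2 ^ Suc h * 2 ^ Suc h)" for i j
    by (rule W) auto
  have "(\<Sum>i<N. \<Sum>j<N. F i j * (W i j * rad k i * rad h j))
      = (\<Sum>i<N. \<Sum>j<N. F i j * (W (i div 2 ^ Suc k * 2 ^ Suc k) (j div 2 ^ Suc h * 2 ^ Suc h)
           * rad k i * rad h j))"
    by (intro sum.cong refl arg_cong2[where f = "(*)"] W_corner)
  also have "\<dots> = (\<Sum>i<2 ^ (n - k) * 2 ^ Suc k. \<Sum>j<2 ^ (n - h) * 2 ^ Suc h. F i j
      * (W (i div 2 ^ Suc k * 2 ^ Suc k) (j div 2 ^ Suc h * 2 ^ Suc h) * rad k i * rad h j))"
    by (simp only: grid_split[OF assms(1), symmetric] grid_split[OF assms(2), symmetric])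
  also note sum_rad_blocks2[where c = "\<lambda>p q. W (p * 2 ^ Suc k) (q * 2 ^ Suc h)"]
  finally show ?thesis .
qed

text \<open>Each free cell has \<open>2 ^ (k + h)\<close> paired rectangles, each of area \<open>2 ^ (k + h)\<close>, and there are \<open>2 ^ (2 * n - k - h)\<close> cells.\<close>

lemma sum_blockwise_bound:
  fixes W :: "nat \<Rightarrow> nat \<Rightarrow> real"
  assumes kh: "k \<le> n" "h \<le> n"
    and W: "\<And>i j i' j'. \<lbrakk>i div 2 ^ Suc k = i' div 2 ^ Suc k; j div 2 ^ Suc h = j' div 2 ^ Suc h\<rbrakk>
      \<Longrightarrow> W i j = W i' j'"
    and bound: "\<And>i j. \<bar>W i j\<bar> \<le> w"
    and supp: "\<And>i j. W i j \<noteq> 0 \<Longrightarrow> free_cell P (Suc k) (Suc h) i j"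
  shows "\<bar>\<Sum>i<N. \<Sum>j<N. T i j * (W i j * rad k i * rad h j)\<bar> \<le> w * B * 2 ^ (2 * n + k + h)"
proof -
  have w: "0 \<le> w" using bound[of 0 0] by linarith
  have four: "(4::real) ^ e = 2 ^ e * 2 ^ e" for e by (simp flip: power_mult_distrib)
  have "\<bar>\<Sum>i<N. \<Sum>j<N. T i j * (W i j * rad k i * rad h j)\<bar>
     \<le> (\<Sum>p<2 ^ (n - k). \<Sum>q<2 ^ (n - h). \<bar>W (p * 2 ^ Suc k) (q * 2 ^ Suc h) *
        (\<Sum>i<2 ^ k. \<Sum>j<2 ^ h.
         mixed_diff T (p * 2 ^ Suc k + i) (p * 2 ^ Suc k + 2 ^ k + i)
                      (q * 2 ^ Suc h + j) (q * 2 ^ Suc h + 2 ^ h + j))\<bar>)"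
    (is "_ \<le> (\<Sum>p<_. \<Sum>q<_. \<bar>?W p q * ?S p q\<bar>)")
    by (subst sum_blockwise[where F = T and W = W, OF kh W], assumption+)
      (intro order.trans[OF sum_abs] sum_mono order.refl)
  also have "\<dots> \<le> (\<Sum>p<(2::nat) ^ (n - k). \<Sum>q<(2::nat) ^ (n - h). w * (B * 4 ^ (k + h)))"
  proof (intro sum_mono)
    fix p q :: nat assume pq: "p \<in> {..<2 ^ (n - k)}" "q \<in> {..<2 ^ (n - h)}"
    show "\<bar>?W p q * ?S p q\<bar> \<le> w * (B * 4 ^ (k + h))"
    proof (cases "?W p q = 0")
      case False
      note free = supp[OF False]
      have D: "A * 2 ^ k * 2 ^ h \<le> mixed_diff T (p * 2 ^ Suc k + i) (p * 2 ^ Suc k + 2 ^ k + i)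
                      (q * 2 ^ Suc h + j) (q * 2 ^ Suc h + 2 ^ h + j)"
         "mixed_diff T (p * 2 ^ Suc k + i) (p * 2 ^ Suc k + 2 ^ k + i)
                      (q * 2 ^ Suc h + j) (q * 2 ^ Suc h + 2 ^ h + j) \<le> B * 2 ^ k * 2 ^ h"
        if "i < 2 ^ k" "j < 2 ^ h" for i j
        using mixed_in_free_cell[OF kh _ _ that free] pq by auto
      have A: "0 \<le> A * 2 ^ k * 2 ^ h" using A_nonneg by simp
      have "0 \<le> ?S p q"
        by (intro sum_nonneg order.trans[OF A D(1)]) auto
      moreover have "?S p q \<le> (\<Sum>i<(2::nat) ^ k. \<Sum>j<(2::nat) ^ h. B * 2 ^ k * 2 ^ h)"
        by (intro sum_mono D(2)) auto
      moreover have "\<dots> = B * 4 ^ (k + h)"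
        by (simp add: four power_add)
      ultimately have "\<bar>?S p q\<bar> \<le> B * 4 ^ (k + h)" by linarith
      then show ?thesis
        unfolding abs_mult by (intro mult_mono bound w) auto
    next
      case True
      then show ?thesis using w B_nonneg by simp
    qed
  qed
  also have "\<dots> = w * B * (2 ^ (n - k) * 2 ^ (n - h) * 4 ^ (k + h))" by simp
  also have "(2::real) ^ (n - k) * 2 ^ (n - h) * 4 ^ (k + h) = 2 ^ (2 * n + k + h)"
  proof -
    have "n - k + (n - h) + (k + h + (k + h)) = 2 * n + k + h" using kh by simp
    then show ?thesis unfolding four by (metis power_add)
  qed
  finally show ?thesis .
qed

text \<open>The mixed differences of a constant vanish.\<close>

lemma sum_blockwise_one:
  fixes W :: "nat \<Rightarrow> nat \<Rightarrow> real"
  assumes "k \<le> n" "h \<le> n"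
    and W: "\<And>i j i' j'. \<lbrakk>i div 2 ^ Suc k = i' div 2 ^ Suc k; j div 2 ^ Suc h = j' div 2 ^ Suc h\<rbrakk>
      \<Longrightarrow> W i j = W i' j'"
  shows "(\<Sum>i<N. \<Sum>j<N. W i j * rad k i * rad h j) = 0"
  using sum_blockwise[where F = "\<lambda>i j. 1" and W = W, OF assms] by (simp add: mixed_diff_def)

text \<open>There are \<open>2 ^ n\<close> cells of each shape, and every point occupies one of them.\<close>

lemma card_free_cells:
  assumes "k \<le> n"
  shows "2 ^ n \<le> 2 * (\<Sum>p<2 ^ (n - k). \<Sum>q<2 ^ k.
      of_bool (free_cell P (Suc k) (Suc (n - k)) (p * 2 ^ Suc k) (q * 2 ^ Suc (n - k))) :: real)"
proof -
  let ?free = "\<lambda>(p, q). free_cell P (Suc k) (Suc (n - k)) (p * 2 ^ Suc k) (q * 2 ^ Suc (n - k))"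
  let ?cells = "{..<2 ^ (n - k)} \<times> {..<2 ^ k} :: (nat \<times> nat) set"
  have "{z \<in> ?cells. \<not> ?free z} \<subseteq> (\<lambda>(u, v). (u div 2 ^ Suc k, v div 2 ^ Suc (n - k))) ` P"
  proof clarify
    fix p q assume "\<not> free_cell P (Suc k) (Suc (n - k)) (p * 2 ^ Suc k) (q * 2 ^ Suc (n - k))"
    then obtain u v where uv: "(u, v) \<in> P" "u div 2 ^ Suc k = p" "v div 2 ^ Suc (n - k) = q"
      unfolding free_cell_def by auto
    show "(p, q) \<in> (\<lambda>(u, v). (u div 2 ^ Suc k, v div 2 ^ Suc (n - k))) ` P"
      by (rule image_eqI[OF _ uv(1)]) (simp only: uv(2,3) prod.case)
  qed
  then have "card {z \<in> ?cells. \<not> ?free z} \<le> card P"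
    using surj_card_le[OF finite_P] by blast
  moreover have "card ?cells = card {z \<in> ?cells. ?free z} + card {z \<in> ?cells. \<not> ?free z}"
    by (rule card_filter_compl) simp
  moreover have "card ?cells = 2 ^ n"
    using assms by (simp add: card_cartesian_product flip: power_add)
  ultimately have "2 ^ n \<le> 2 * card {z \<in> ?cells. ?free z}" using card_P by linarith
  then have "real (2 ^ n) \<le> real (2 * card {z \<in> ?cells. ?free z})"
    by (simp only: of_nat_le_iff)
  then have "(2::real) ^ n \<le> 2 * real (card {z \<in> ?cells. ?free z})"
    by (simp only: of_nat_mult of_nat_power of_nat_numeral)
  also have "real (card {z \<in> ?cells. ?free z}) = (\<Sum>z\<in>?cells. of_bool (?free z))"
    by (simp add: Int_def)
  also have "\<dots> = (\<Sum>p<2 ^ (n - k). \<Sum>q<2 ^ k.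
      of_bool (free_cell P (Suc k) (Suc (n - k)) (p * 2 ^ Suc k) (q * 2 ^ Suc (n - k))))"
    unfolding sum.cartesian_product by (rule sum.cong) (auto simp only: split: prod.split)
  finally show ?thesis .
qed

definition gsum :: "(nat \<Rightarrow> nat \<Rightarrow> real) \<Rightarrow> real" where
  "gsum F = (\<Sum>i<N. \<Sum>j<N. F i j)"

lemma gsum_add: "gsum (\<lambda>i j. F i j + G i j) = gsum F + gsum G"
  by (simp add: gsum_def sum.distrib)

lemma gsum_cmult: "gsum (\<lambda>i j. c * F i j) = c * gsum F"
  by (simp add: gsum_def sum_distrib_left)

lemma gsum_sum: "gsum (\<lambda>i j. \<Sum>k\<in>K. F k i j) = (\<Sum>k\<in>K. gsum (F k))"
proof -
  have "gsum (\<lambda>i j. \<Sum>k\<in>K. F k i j) = (\<Sum>i<N. \<Sum>k\<in>K. \<Sum>j<N. F k i j)"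
    unfolding gsum_def by (intro sum.cong refl sum.swap)
  also have "\<dots> = (\<Sum>k\<in>K. gsum (F k))" unfolding gsum_def by (rule sum.swap)
  finally show ?thesis .
qed

lemma gsum_mono: "(\<And>i j. i < N \<Longrightarrow> j < N \<Longrightarrow> F i j \<le> G i j) \<Longrightarrow> gsum F \<le> gsum G"
  unfolding gsum_def by (intro sum_mono) auto

lemma gsum_const: "gsum (\<lambda>i j. c) = 4 * 4 ^ n * c"
proof -
  have "(4::real) ^ n = 2 ^ n * 2 ^ n" by (simp flip: power_mult_distrib)
  then show ?thesis by (simp add: gsum_def)
qed

text \<open>All mixed differences that occur are over free rectangles and hence nonnegative, so the correlations over the free
  cells, at least half of all cells, add up without cancellation.\<close>

lemma first_order:
  assumes "k \<le> n"
  shows "A * 8 ^ n / 2 \<le> gsum (\<lambda>i j. T i j * r_fun n P k i j)"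
    and "gsum (r_fun n P k) = 0"
proof -
  let ?h = "n - k"
  define W where "W i j = (of_bool (free_cell P (Suc k) (Suc ?h) i j) :: real)" for i j
  have kh: "k \<le> n" "?h \<le> n" and nh: "n - ?h = k" using assms by auto
  have W: "W i j = W i' j'" if "i div 2 ^ Suc k = i' div 2 ^ Suc k" "j div 2 ^ Suc ?h = j' div 2 ^ Suc ?h"
    for i j i' j'
    unfolding W_def using free_cell_cong[OF that order.refl order.refl] by simp
  have r: "r_fun n P k i j = W i j * rad k i * rad ?h j" for i j
    by (simp add: r_fun_def W_def)
  show "gsum (r_fun n P k) = 0"
    unfolding gsum_def r by (rule sum_blockwise_one[OF kh W])
  have pow: "(2::real) ^ k * (2 ^ ?h * (A * 2 ^ k * 2 ^ ?h)) = A * 4 ^ n"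
  proof -
    have "(4::real) ^ n = 2 ^ n * 2 ^ n" by (simp flip: power_mult_distrib)
    moreover have "(2::real) ^ k * 2 ^ ?h = 2 ^ n" using assms by (simp flip: power_add)
    ultimately show ?thesis by (metis mult.assoc mult.commute)
  qed
  have "A * 8 ^ n / 2 = 2 ^ n / 2 * (A * 4 ^ n)"
    by (simp flip: power_mult_distrib)
  also have "\<dots> \<le> (\<Sum>p<2 ^ ?h. \<Sum>q<2 ^ k. W (p * 2 ^ Suc k) (q * 2 ^ Suc ?h)) * (A * 4 ^ n)"
    using card_free_cells[OF assms] A_nonneg unfolding W_def by (intro mult_right_mono) auto
  also have "\<dots> = (\<Sum>p<2 ^ ?h. \<Sum>q<2 ^ k. W (p * 2 ^ Suc k) (q * 2 ^ Suc ?h) * (A * 4 ^ n))"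
    by (simp add: sum_distrib_right)
  also have "\<dots> \<le> (\<Sum>p<2 ^ ?h. \<Sum>q<2 ^ k. W (p * 2 ^ Suc k) (q * 2 ^ Suc ?h) *
        (\<Sum>i<2 ^ k. \<Sum>j<2 ^ ?h.
         mixed_diff T (p * 2 ^ Suc k + i) (p * 2 ^ Suc k + 2 ^ k + i)
                      (q * 2 ^ Suc ?h + j) (q * 2 ^ Suc ?h + 2 ^ ?h + j)))"
    (is "_ \<le> (\<Sum>p<_. \<Sum>q<_. _ * ?S p q)")
  proof (intro sum_mono)
    fix p q :: nat assume pq: "p \<in> {..<2 ^ ?h}" "q \<in> {..<2 ^ k}"
    show "W (p * 2 ^ Suc k) (q * 2 ^ Suc ?h) * (A * 4 ^ n) \<le> W (p * 2 ^ Suc k) (q * 2 ^ Suc ?h) * ?S p q"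
    proof (cases "free_cell P (Suc k) (Suc ?h) (p * 2 ^ Suc k) (q * 2 ^ Suc ?h)")
      case True
      have "(\<Sum>i<(2::nat) ^ k. \<Sum>j<(2::nat) ^ ?h. A * 2 ^ k * 2 ^ ?h) \<le> ?S p q"
        using pq nh by (intro sum_mono mixed_in_free_cell(1)[OF kh _ _ _ _ True]) auto
      then have "A * 4 ^ n \<le> ?S p q" using pow by simp
      then show ?thesis unfolding W_def by simp
    qed (simp add: W_def)
  qed
  also have "\<dots> = gsum (\<lambda>i j. T i j * r_fun n P k i j)"
    unfolding gsum_def r
    by (subst sum_blockwise[where F = T and W = W, OF kh W], assumption+) (simp only: nh)
  finally show "A * 8 ^ n / 2 \<le> gsum (\<lambda>i j. T i j * r_fun n P k i j)" .
qed

text \<open>In the first coordinate the lowest digit that occurs is \<open>a\<close> and comes from one factor only; in the second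
  coordinate it is \<open>n - b\<close> and also comes from one factor only. All other factors are constant on cells of size
  \<open>2 ^ (a + 1)\<close> by \<open>2 ^ (n - b + 1)\<close>. Such a cell is smaller than a cell of shape \<open>a\<close> by the factor \<open>2 ^ (b - a)\<close> and lies in
  one, so it is free wherever \<open>r_fun n P a\<close> does not vanish.\<close>

lemma second_order:
  fixes \<gamma> :: real
  assumes ab: "a < b" "b \<le> n" and \<gamma>: "0 \<le> \<gamma>"
  defines "Q \<equiv> \<lambda>i j. r_fun n P a i j * r_fun n P b i j * (\<Prod>k\<in>{a<..<b}. 1 + \<gamma> * r_fun n P k i j)"
  shows "\<bar>gsum (\<lambda>i j. T i j * Q i j)\<bar> \<le> B * 8 ^ n * ((1 + \<gamma>) ^ (b - Suc a) / 2 ^ (b - a))"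
    and "gsum Q = 0"
proof -
  let ?h = "n - b"
  define W where "W i j = of_bool (free_cell P (Suc a) (Suc (n - a)) i j)
      * rad (n - a) j * (of_bool (free_cell P (Suc b) (Suc ?h) i j) * rad b i)
      * (\<Prod>k\<in>{a<..<b}. 1 + \<gamma> * r_fun n P k i j)" for i j
  have kh: "a \<le> n" "?h \<le> n" using ab by auto
  have Q: "Q i j = W i j * rad a i * rad ?h j" for i j
    by (simp add: Q_def W_def r_fun_def)
  have W: "W i j = W i' j'" if "i div 2 ^ Suc a = i' div 2 ^ Suc a" "j div 2 ^ Suc ?h = j' div 2 ^ Suc ?h"
    for i j i' j'
  proof -
    note F = free_cell_cong[OF that, where P = P] and Ri = rad_cong[OF that(1)] and Rj = rad_cong[OF that(2)]
    have "r_fun n P k i j = r_fun n P k i' j'" if "k \<in> {a<..<b}" for k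
    proof -
      have "Suc a \<le> k" "Suc ?h \<le> n - k" using that ab by auto
      then show ?thesis using F[of "Suc k" "Suc (n - k)"] Ri[of k] Rj[of "n - k"] by (simp add: r_fun_def)
    qed
    then have "(\<Prod>k\<in>{a<..<b}. 1 + \<gamma> * r_fun n P k i j) = (\<Prod>k\<in>{a<..<b}. 1 + \<gamma> * r_fun n P k i' j')"
      by (intro prod.cong) auto
    moreover have "free_cell P (Suc a) (Suc (n - a)) i j = free_cell P (Suc a) (Suc (n - a)) i' j'"
      using ab by (intro F) auto
    moreover have "free_cell P (Suc b) (Suc ?h) i j = free_cell P (Suc b) (Suc ?h) i' j'"
      using ab by (intro F) auto
    moreover have "rad (n - a) j = rad (n - a) j'" using ab by (intro Rj) auto
    moreover have "rad b i = rad b i'" using ab by (intro Ri) auto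
    ultimately show ?thesis by (simp only: W_def)
  qed
  show "gsum Q = 0"
    unfolding gsum_def Q by (rule sum_blockwise_one[OF kh W])
  have bound: "\<bar>W i j\<bar> \<le> (1 + \<gamma>) ^ (b - Suc a)" for i j
  proof -
    have "\<bar>1 + \<gamma> * r_fun n P k i j\<bar> \<le> 1 + \<gamma>" for k
    proof -
      have "\<bar>\<gamma> * r_fun n P k i j\<bar> \<le> \<gamma>"
        using mult_left_mono[OF abs_r_fun_le \<gamma>] \<gamma> by (simp add: abs_mult)
      then show ?thesis by linarith
    qed
    then have "(\<Prod>k\<in>{a<..<b}. \<bar>1 + \<gamma> * r_fun n P k i j\<bar>) \<le> (\<Prod>k\<in>{a<..<b}. 1 + \<gamma>)"
      by (intro prod_mono) auto
    then have "\<bar>\<Prod>k\<in>{a<..<b}. 1 + \<gamma> * r_fun n P k i j\<bar> \<le> (1 + \<gamma>) ^ (b - Suc a)"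
      by (simp add: abs_prod)
    moreover have "0 \<le> (1 + \<gamma>) ^ (b - Suc a)" using \<gamma> by simp
    ultimately show ?thesis by (auto simp: W_def abs_mult)
  qed
  have supp: "free_cell P (Suc a) (Suc ?h) i j" if "W i j \<noteq> 0" for i j
  proof -
    have "free_cell P (Suc a) (Suc (n - a)) i j" using that by (auto simp: W_def)
    then show ?thesis using ab by (elim free_cell_mono) auto
  qed
  have pow: "(2::real) ^ (2 * n + a + ?h) = 8 ^ n / 2 ^ (b - a)"
  proof -
    have "(8::real) ^ n = 2 ^ (3 * n)" by (simp only: power_mult) simp
    moreover have "3 * n = (2 * n + a + ?h) + (b - a)" using ab by simp
    ultimately have "(8::real) ^ n = 2 ^ (2 * n + a + ?h) * 2 ^ (b - a)" by (metis power_add)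
    then show ?thesis by simp
  qed
  show "\<bar>gsum (\<lambda>i j. T i j * Q i j)\<bar> \<le> B * 8 ^ n * ((1 + \<gamma>) ^ (b - Suc a) / 2 ^ (b - a))"
  proof -
    have "\<bar>\<Sum>i<N. \<Sum>j<N. T i j * (W i j * rad a i * rad ?h j)\<bar>
        \<le> (1 + \<gamma>) ^ (b - Suc a) * B * 2 ^ (2 * n + a + ?h)"
      by (rule sum_blockwise_bound[OF kh W bound supp])
    then show ?thesis unfolding gsum_def Q pow by (simp add: mult_ac)
  qed
qed

lemma geometric_tail:
  fixes \<gamma> :: real
  assumes "0 \<le> \<gamma>" "\<gamma> \<le> 1 / 2"
  shows "(\<Sum>a<b. (1 + \<gamma>) ^ (b - Suc a) / 2 ^ (b - a)) \<le> 2"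
proof -
  have "(\<Sum>a<b. (1 + \<gamma>) ^ (b - Suc a) / 2 ^ (b - a)) \<le> (\<Sum>a<b. 1 / 2 * (3 / 4) ^ (b - Suc a))"
  proof (rule sum_mono)
    fix a assume "a \<in> {..<b}"
    then have "b - a = Suc (b - Suc a)" by auto
    then have "(1 + \<gamma>) ^ (b - Suc a) / 2 ^ (b - a) = 1 / 2 * ((1 + \<gamma>) / 2) ^ (b - Suc a)"
      by (simp add: power_divide)
    also have "\<dots> \<le> 1 / 2 * (3 / 4) ^ (b - Suc a)"
      using assms by (intro mult_left_mono power_mono) auto
    finally show "(1 + \<gamma>) ^ (b - Suc a) / 2 ^ (b - a) \<le> 1 / 2 * (3 / 4) ^ (b - Suc a)" .
  qed
  also have "\<dots> = 1 / 2 * (\<Sum>a<b. (3 / 4) ^ a)"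
    unfolding sum_distrib_left[symmetric] sum.nat_diff_reindex ..
  also have "\<dots> \<le> 2" by (simp add: sum_gp_strict)
  finally show ?thesis .
qed

text \<open>\<open>T\<close> is tested against the Riesz product \<open>R\<close> minus one. Because \<open>R\<close> is nonnegative and has the same sum over the grid
  as the constant one, \<open>\<bar>R - 1\<bar>\<close> has a mean of at most two and the correlation is at most \<open>2 * m\<close> per grid point.\<close>

theorem sup_norm_lower_bound:
  fixes \<gamma> m :: real
  assumes \<gamma>: "0 \<le> \<gamma>" "\<gamma> \<le> 1 / 2"
    and m: "\<And>i j. i < N \<Longrightarrow> j < N \<Longrightarrow> \<bar>T i j\<bar> \<le> m"
  shows "real (Suc n) * 2 ^ n * (\<gamma> * A / 2 - 2 * \<gamma>\<^sup>2 * B) \<le> 8 * m"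
proof -
  define r where "r = r_fun n P"
  define R where "R i j = (\<Prod>k<Suc n. 1 + \<gamma> * r k i j)" for i j
  define Q where "Q a b i j = r a i j * r b i j * (\<Prod>k\<in>{a<..<b}. 1 + \<gamma> * r k i j)" for a b i j
  have R_nonneg: "0 \<le> R i j" for i j
  proof -
    have "0 \<le> 1 + \<gamma> * r k i j" for k
    proof -
      have "\<bar>\<gamma> * r k i j\<bar> \<le> \<gamma>"
        using mult_left_mono[OF abs_r_fun_le \<gamma>(1)] \<gamma> by (simp add: abs_mult r_def)
      then show ?thesis using \<gamma> by linarith
    qed
    then show ?thesis unfolding R_def by (intro prod_nonneg) auto
  qed
  have R: "R i j = 1 + (\<gamma> * (\<Sum>b<Suc n. r b i j) + \<gamma>\<^sup>2 * (\<Sum>b<Suc n. \<Sum>a<b. Q a b i j))" for i j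
    unfolding R_def prod_one_plus_expand Q_def
    by (simp add: sum_distrib_left power2_eq_square mult_ac del: sum.lessThan_Suc)
  have Q0: "gsum (Q a b) = 0" "\<bar>gsum (\<lambda>i j. T i j * Q a b i j)\<bar> \<le> B * 8 ^ n * ((1 + \<gamma>) ^ (b - Suc a) / 2 ^ (b - a))"
    if "a < b" "b \<le> n" for a b
    using second_order[OF that \<gamma>(1)] unfolding Q_def r_def by auto
  have r0: "gsum (r b) = 0" "A * 8 ^ n / 2 \<le> gsum (\<lambda>i j. T i j * r b i j)" if "b \<le> n" for b
    using first_order[OF that] unfolding r_def by auto
  have mass: "gsum R = 4 * 4 ^ n"
    unfolding R gsum_add gsum_cmult gsum_sum using r0(1) Q0(1) by (simp add: gsum_const del: sum.lessThan_Suc)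
  have "real (Suc n) * 8 ^ n * (\<gamma> * A / 2 - 2 * \<gamma>\<^sup>2 * B)
      = \<gamma> * (\<Sum>b<Suc n. A * 8 ^ n / 2) - \<gamma>\<^sup>2 * (\<Sum>b<Suc n. B * 8 ^ n * 2)"
    by (simp add: algebra_simps)
  also have "\<dots> \<le> \<gamma> * (\<Sum>b<Suc n. gsum (\<lambda>i j. T i j * r b i j))
       + \<gamma>\<^sup>2 * (\<Sum>b<Suc n. \<Sum>a<b. gsum (\<lambda>i j. T i j * Q a b i j))"
  proof -
    have "(\<Sum>b<Suc n. A * 8 ^ n / 2) \<le> (\<Sum>b<Suc n. gsum (\<lambda>i j. T i j * r b i j))"
      by (intro sum_mono r0(2)) auto
    then have 1: "\<gamma> * (\<Sum>b<Suc n. A * 8 ^ n / 2) \<le> \<gamma> * (\<Sum>b<Suc n. gsum (\<lambda>i j. T i j * r b i j))"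
      using \<gamma>(1) by (rule mult_left_mono)
    have "- (B * 8 ^ n * 2) \<le> (\<Sum>a<b. gsum (\<lambda>i j. T i j * Q a b i j))" if "b < Suc n" for b
    proof -
      have "\<bar>\<Sum>a<b. gsum (\<lambda>i j. T i j * Q a b i j)\<bar>
          \<le> (\<Sum>a<b. B * 8 ^ n * ((1 + \<gamma>) ^ (b - Suc a) / 2 ^ (b - a)))"
        using that by (intro order.trans[OF sum_abs] sum_mono Q0(2)) auto
      also have "\<dots> \<le> B * 8 ^ n * 2"
        unfolding sum_distrib_left[symmetric] using B_nonneg
        by (intro mult_left_mono geometric_tail \<gamma>) auto
      finally show ?thesis by linarith
    qed
    then have "(\<Sum>b<Suc n. - (B * 8 ^ n * 2)) \<le> (\<Sum>b<Suc n. \<Sum>a<b. gsum (\<lambda>i j. T i j * Q a b i j))"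
      by (intro sum_mono) auto
    then have "\<gamma>\<^sup>2 * (\<Sum>b<Suc n. - (B * 8 ^ n * 2))
        \<le> \<gamma>\<^sup>2 * (\<Sum>b<Suc n. \<Sum>a<b. gsum (\<lambda>i j. T i j * Q a b i j))"
      by (rule mult_left_mono) simp
    then show ?thesis using 1 by (simp add: sum_negf del: sum.lessThan_Suc)
  qed
  also have "\<dots> = gsum (\<lambda>i j. T i j * (R i j - 1))"
  proof -
    have "gsum (\<lambda>i j. T i j * (R i j - 1)) = gsum (\<lambda>i j.
        \<gamma> * (\<Sum>b<Suc n. T i j * r b i j) + \<gamma>\<^sup>2 * (\<Sum>b<Suc n. \<Sum>a<b. T i j * Q a b i j))"
      unfolding R by (simp add: distrib_left sum_distrib_left mult_ac del: sum.lessThan_Suc)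
    then show ?thesis by (simp only: gsum_add gsum_cmult gsum_sum)
  qed
  also have "\<dots> \<le> gsum (\<lambda>i j. m * (R i j + 1))"
  proof (rule gsum_mono)
    fix i j assume "i < N" "j < N"
    have "T i j * (R i j - 1) \<le> \<bar>T i j\<bar> * \<bar>R i j - 1\<bar>" by (metis abs_ge_self abs_mult)
    also have "\<dots> \<le> m * (R i j + 1)"
      using R_nonneg[of i j] m[OF \<open>i < N\<close> \<open>j < N\<close>] by (intro mult_mono) auto
    finally show "T i j * (R i j - 1) \<le> m * (R i j + 1)" .
  qed
  also have "\<dots> = 4 ^ n * (8 * m)"
    unfolding gsum_cmult gsum_add mass gsum_const by simp
  finally have total: "real (Suc n) * 8 ^ n * (\<gamma> * A / 2 - 2 * \<gamma>\<^sup>2 * B) \<le> 4 ^ n * (8 * m)" .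
  have eight: "(8::real) ^ n = 4 ^ n * 2 ^ n" by (simp flip: power_mult_distrib)
  have "4 ^ n * (real (Suc n) * 2 ^ n * (\<gamma> * A / 2 - 2 * \<gamma>\<^sup>2 * B)) \<le> 4 ^ n * (8 * m)"
    using total unfolding eight by (simp add: mult_ac)
  then show ?thesis by (rule mult_left_le_imp_le) simp
qed

end

section \<open>Hausdorff length of a segment\<close>

text \<open>Pulled back to the interval, a set of diameter \<open>d\<close> fits into an interval of length \<open>d\<close>, so countable subadditivity
  of Lebesgue measure bounds every cover from below. Cutting into equal pieces attains the bound.\<close>

lemma hausdorff1_isometric_interval:
  fixes f :: "real \<Rightarrow> 'a::metric_space"
  assumes ab: "a \<le> b"
    and iso: "\<And>s t. s \<in> {a..b} \<Longrightarrow> t \<in> {a..b} \<Longrightarrow> dist (f s) (f t) = \<bar>s - t\<bar>"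
  shows "hausdorff1 (f ` {a..b}) = ennreal (b - a)"
proof (rule antisym)
  have lower: "ennreal (b - a) \<le> (\<Sum>i. ennreal (diameter (U i)))" if U: "U \<in> delta_covers \<delta> (f ` {a..b})" for U \<delta>
  proof -
    define V where "V i = {t \<in> {a..b}. f t \<in> U i}" for i
    define J where "J i = {Inf (V i)..Inf (V i) + diameter (U i)}" for i
    have bdd: "bounded (U i)" for i using U by (simp add: delta_covers_def)
    have VJ: "V i \<subseteq> J i" for i
    proof
      fix t assume t: "t \<in> V i"
      have "t - diameter (U i) \<le> s" if s: "s \<in> V i" for s
        using diameter_bounded_bound[OF bdd, of "f t" i "f s"] iso[of t s] s t by (auto simp: V_def)
      then have "t - diameter (U i) \<le> Inf (V i)" using t by (intro cInf_greatest) auto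
      moreover have "Inf (V i) \<le> t" using t by (intro cInf_lower bdd_belowI[of _ a]) (auto simp: V_def)
      ultimately show "t \<in> J i" by (simp add: J_def)
    qed
    have "{a..b} \<subseteq> (\<Union>i. V i)"
    proof -
      have "\<exists>i. f t \<in> U i" if "t \<in> {a..b}" for t
        using U that unfolding delta_covers_def by blast
      then show ?thesis by (auto simp: V_def)
    qed
    then have cover: "{a..b} \<subseteq> (\<Union>i. J i)"
      by (rule order.trans) (intro UN_mono subset_refl VJ)
    have "ennreal (b - a) = emeasure lborel {a..b}" using ab by simp
    also have "\<dots> \<le> emeasure lborel (\<Union>i. J i)" using cover by (intro emeasure_mono) (auto simp: J_def)
    also have "\<dots> \<le> (\<Sum>i. emeasure lborel (J i))"
      by (intro emeasure_subadditive_countably) (auto simp: J_def)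
    also have "\<dots> = (\<Sum>i. ennreal (diameter (U i)))"
      using diameter_ge_0[OF bdd] by (simp add: J_def)
    finally show ?thesis .
  qed
  have "ennreal (b - a) \<le> (INF U\<in>delta_covers 1 (f ` {a..b}). \<Sum>i. ennreal (diameter (U i)))"
    by (intro INF_greatest lower)
  then show "ennreal (b - a) \<le> hausdorff1 (f ` {a..b})"
    unfolding hausdorff1_def by (rule SUP_upper2[rotated]) simp
next
  have "(INF U\<in>delta_covers \<delta> (f ` {a..b}). \<Sum>i. ennreal (diameter (U i))) \<le> ennreal (b - a)"
    if \<delta>: "\<delta> > 0" for \<delta>
  proof -
    obtain n :: nat where n: "(b - a) / \<delta> < n" using reals_Archimedean2 by blast
    then have n0: "n > 0" using ab \<delta> by (metis diff_ge_0_iff_ge divide_nonneg_pos gr0I not_less of_nat_0)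
    define w where "w = (b - a) / n"
    have w: "0 \<le> w" "w \<le> \<delta>" "n * w = b - a"
      using n n0 ab \<delta> by (simp_all add: w_def pos_divide_le_eq pos_divide_less_eq mult.commute)
    define U where "U i = (if i < n then f ` {a + i * w..a + (i + 1) * w} else {})" for i :: nat
    have sub: "{a + i * w..a + (i + 1) * w} \<subseteq> {a..b}" if "i < n" for i :: nat
    proof -
      have "real (i + 1) * w \<le> n * w" using that w by (intro mult_right_mono) auto
      moreover have "0 \<le> i * w" using w by simp
      ultimately show ?thesis using w by auto
    qed
    have small: "dist p q \<le> w" if pq: "p \<in> U i" "q \<in> U i" for p q i
    proof -
      have i: "i < n" using pq by (auto simp: U_def split: if_splits)
      obtain s where s: "s \<in> {a + i * w..a + (i + 1) * w}" "p = f s"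
        using pq(1) i unfolding U_def by auto
      obtain t where t: "t \<in> {a + i * w..a + (i + 1) * w}" "q = f t"
        using pq(2) i unfolding U_def by auto
      note st = s t
      from st have "dist p q = \<bar>s - t\<bar>" using iso sub[OF i] by blast
      also have "\<dots> \<le> w" using st by (auto simp: algebra_simps abs_le_iff)
      finally show ?thesis .
    qed
    have bdd: "bounded (U i)" for i
      unfolding bounded_def using small by meson
    have dia: "diameter (U i) \<le> w" for i
      using small[of _ i] w by (auto simp: diameter_def intro!: cSUP_least)
    have cover: "f ` {a..b} \<subseteq> (\<Union>i. U i)"
    proof clarify
      fix t assume t: "t \<in> {a..b}"
      show "f t \<in> (\<Union>i. U i)"
      proof (cases "t < b")
        case True
        then have w0: "w > 0" using t n0 by (auto simp: w_def)
        define i where "i = nat \<lfloor>(t - a) / w\<rfloor>"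
        have "0 \<le> (t - a) / w" using t w0 by simp
        then have "real i \<le> (t - a) / w" "(t - a) / w < real i + 1"
          unfolding i_def by linarith+
        then have i: "real i * w \<le> t - a" "t - a < (real i + 1) * w"
          using w0 by (simp_all only: pos_le_divide_eq pos_divide_less_eq)
        then have "real i * w < n * w" using w(3) True by linarith
        then have "i < n" using w0 by simp
        moreover have "t \<in> {a + i * w..a + (i + 1) * w}" using i by (simp add: algebra_simps)
        ultimately show ?thesis by (auto simp: U_def)
      next
        case False
        then have "t = a + (real (n - 1) + 1) * w" using t w n0 by (simp add: of_nat_diff)
        moreover have "a + real (n - 1) * w \<le> a + (real (n - 1) + 1) * w" using w by (simp add: algebra_simps)
        ultimately have "f t \<in> U (n - 1)" using n0 by (auto simp: U_def)
        then show ?thesis by blast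
      qed
    qed
    have "U \<in> delta_covers \<delta> (f ` {a..b})"
      using cover bdd order.trans[OF dia w(2)] by (auto simp: delta_covers_def)
    then have "(INF U\<in>delta_covers \<delta> (f ` {a..b}). \<Sum>i. ennreal (diameter (U i))) \<le> (\<Sum>i. ennreal (diameter (U i)))"
      by (rule INF_lower)
    also have "\<dots> = (\<Sum>i<n. ennreal (diameter (U i)))"
      by (rule suminf_finite) (auto simp: U_def)
    also have "\<dots> \<le> (\<Sum>i<n. ennreal w)"
      by (intro sum_mono ennreal_leI dia)
    also have "\<dots> = ennreal (b - a)"
      using w by (simp add: ennreal_of_nat_eq_real_of_nat flip: ennreal_mult)
    finally show ?thesis .
  qed
  then show "hausdorff1 (f ` {a..b}) \<le> ennreal (b - a)"
    unfolding hausdorff1_def by (intro SUP_least) auto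
qed

lemma len_isometric_interval:
  fixes f :: "real \<Rightarrow> 'a::metric_space"
  assumes "a \<le> b" "\<And>s t. s \<in> {a..b} \<Longrightarrow> t \<in> {a..b} \<Longrightarrow> dist (f s) (f t) = \<bar>s - t\<bar>"
  shows "len (f ` {a..b}) = b - a"
  using hausdorff1_isometric_interval[OF assms] assms(1) by (simp add: len_def)


section \<open>Lines in the disk and the ends of a chord\<close>

text \<open>Arc length parametrisation of a line, starting at the foot of the perpendicular from the origin.\<close>

definition on_line :: "real \<Rightarrow> real \<Rightarrow> real \<Rightarrow> plane" where
  "on_line \<theta> p w = vector [p * cos \<theta> - w * sin \<theta>, p * sin \<theta> + w * cos \<theta>]"

lemma on_line_nth [simp]:
  "on_line \<theta> p w $ 1 = p * cos \<theta> - w * sin \<theta>" "on_line \<theta> p w $ 2 = p * sin \<theta> + w * cos \<theta>"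
  by (simp_all add: on_line_def)

lemma line_of_eq_range: "line_of (\<theta>, p) = range (on_line \<theta> p)"
proof (intro equalityI subsetI)
  fix x assume "x \<in> line_of (\<theta>, p)"
  then have p: "p = cos \<theta> * x$1 + sin \<theta> * x$2" by (simp add: line_of_def)
  have "x$1 * (cos \<theta> * cos \<theta> + sin \<theta> * sin \<theta>) = p * cos \<theta> - (cos \<theta> * x$2 - sin \<theta> * x$1) * sin \<theta>"
    "x$2 * (cos \<theta> * cos \<theta> + sin \<theta> * sin \<theta>) = p * sin \<theta> + (cos \<theta> * x$2 - sin \<theta> * x$1) * cos \<theta>"
    unfolding p by algebra+
  then have "x = on_line \<theta> p (cos \<theta> * x$2 - sin \<theta> * x$1)"
    by (simp add: vec_eq_iff forall_2)
  then show "x \<in> range (on_line \<theta> p)" by blast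
next
  fix x assume "x \<in> range (on_line \<theta> p)"
  then obtain w where x: "x = on_line \<theta> p w" by blast
  have "cos \<theta> * (p * cos \<theta> - w * sin \<theta>) + sin \<theta> * (p * sin \<theta> + w * cos \<theta>)
      = p * (cos \<theta> * cos \<theta> + sin \<theta> * sin \<theta>)"
    by algebra
  then show "x \<in> line_of (\<theta>, p)"
    by (simp add: line_of_def x)
qed

lemma norm_on_line: "(norm (on_line \<theta> p w))\<^sup>2 = p\<^sup>2 + w\<^sup>2"
proof -
  have "(norm (on_line \<theta> p w))\<^sup>2 = (p\<^sup>2 + w\<^sup>2) * (cos \<theta> * cos \<theta> + sin \<theta> * sin \<theta>)"
    unfolding power2_norm_eq_inner inner_vec_def sum_2 on_line_nth inner_real_def by algebra
  then show ?thesis by simp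
qed

lemma dist_on_line: "dist (on_line \<theta> p s) (on_line \<theta> p t) = \<bar>s - t\<bar>"
proof -
  have "on_line \<theta> p s - on_line \<theta> p t = on_line \<theta> 0 (s - t)"
    by (simp add: vec_eq_iff forall_2 algebra_simps)
  then have "(dist (on_line \<theta> p s) (on_line \<theta> p t))\<^sup>2 = \<bar>s - t\<bar>\<^sup>2"
    using norm_on_line[of \<theta> 0 "s - t"] by (simp add: dist_norm)
  then show ?thesis using power2_eq_iff_nonneg[of "dist (on_line \<theta> p s) (on_line \<theta> p t)" "\<bar>s - t\<bar>"]
    by simp
qed

lemma line_of_inter_disk:
  assumes "p\<^sup>2 + h\<^sup>2 = 1" "0 \<le> h"
  shows "line_of (\<theta>, p) \<inter> unit_disk = on_line \<theta> p ` {-h..h}"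
proof -
  have "norm (on_line \<theta> p w) \<le> 1 \<longleftrightarrow> w \<in> {-h..h}" for w
  proof -
    have "norm (on_line \<theta> p w) \<le> 1 \<longleftrightarrow> w\<^sup>2 \<le> h\<^sup>2"
      using assms(1) norm_on_line[of \<theta> p w] abs_le_square_iff[of "norm (on_line \<theta> p w)" 1] by auto
    then show ?thesis using abs_le_square_iff[of w h] assms(2) by (auto simp: abs_le_iff)
  qed
  then show ?thesis unfolding line_of_eq_range by auto
qed

lemma len_line_of_inter_disk:
  assumes "p\<^sup>2 + h\<^sup>2 = 1" "0 \<le> h"
  shows "len (line_of (\<theta>, p) \<inter> unit_disk) = 2 * h"
  unfolding line_of_inter_disk[OF assms]
  using len_isometric_interval[where f = "on_line \<theta> p" and a = "-h" and b = h] assms(2)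
  by (simp add: dist_on_line)

text \<open>A shift of the angle by \<open>2 * pi\<close> changes the sine of the half angle only in sign.\<close>

lemma half_angle_sine_mod_2pi:
  obtains \<alpha> \<sigma> :: real where "0 \<le> \<alpha>" "\<alpha> < 2 * pi" "\<sigma> \<noteq> 0"
    "\<And>x. sin ((x - \<alpha>') / 2) = \<sigma> * sin ((x - \<alpha>) / 2)"
proof -
  define k where "k = \<lfloor>\<alpha>' / (2 * pi)\<rfloor>"
  define \<alpha> where "\<alpha> = \<alpha>' - 2 * (k * pi)"
  have "of_int k \<le> \<alpha>' / (2 * pi)" "\<alpha>' / (2 * pi) < of_int k + 1"
    unfolding k_def by linarith+
  then have "of_int k * (2 * pi) \<le> \<alpha>'" "\<alpha>' < (of_int k + 1) * (2 * pi)"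
    using pi_gt_zero by (simp_all only: pos_le_divide_eq pos_divide_less_eq mult_pos_pos zero_less_numeral)
  then have \<alpha>: "0 \<le> \<alpha>" "\<alpha> < 2 * pi" by (simp_all add: \<alpha>_def algebra_simps)
  have s: "sin (k * pi) = 0" using sin_zero_iff_int2 by blast
  then have c: "cos (k * pi) \<noteq> 0" using sin_cos_squared_add[of "k * pi"] by auto
  have "sin ((x - \<alpha>') / 2) = cos (k * pi) * sin ((x - \<alpha>) / 2)" for x
  proof -
    have shift: "(x - \<alpha>') / 2 = (x - \<alpha>) / 2 - k * pi" by (simp add: \<alpha>_def diff_divide_distrib)
    show ?thesis unfolding shift sin_diff s by simp
  qed
  then show ?thesis using that[OF \<alpha> c] by blast
qed

text \<open>Along the circle, the equation of a line at distance \<open>cos \<phi>\<close> from the origin with normal angle \<open>t\<close> is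
  \<open>cos (x - t) - cos \<phi>\<close>. The sum-to-product formula factors it, and the factors show the two boundary angles \<open>t - \<phi>\<close> and
  \<open>t + \<phi>\<close> of the line.\<close>

lemma line_as_half_angle_sines:
  assumes "is_line g" "g \<inter> unit_disk \<noteq> {}"
  obtains \<alpha> \<beta> \<kappa> t p :: real where "0 \<le> \<alpha>" "\<alpha> \<le> \<beta>" "\<beta> < 2 * pi" "\<kappa> \<noteq> 0"
    "g = line_of (t, p)"
    "\<And>x. cos t * cos x + sin t * sin x - p = \<kappa> * (sin ((x - \<alpha>) / 2) * sin ((x - \<beta>) / 2))"
proof -
  have "g \<in> space line_measure" using assms(1) by (simp add: space_line_measure)
  then obtain t p where g: "g = line_of (t, p)"
    by (auto simp: line_measure_def space_embed_measure)
  obtain w where "norm (on_line t p w) \<le> 1"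
    using assms(2) unfolding g line_of_eq_range by auto
  then have "p\<^sup>2 + w\<^sup>2 \<le> 1" using norm_on_line[of t p w] by (metis norm_ge_zero power_le_one)
  then have "p\<^sup>2 \<le> 1" using zero_le_power2[of w] by linarith
  then have "\<bar>p\<bar> \<le> 1" by (simp add: abs_square_le_1)
  then have p: "p = cos (arccos p)" by (simp add: cos_arccos_abs)
  have F: "cos t * cos x + sin t * sin x - p
      = -2 * (sin ((x - (t - arccos p)) / 2) * sin ((x - (t + arccos p)) / 2))" for x
  proof -
    have "cos t * cos x + sin t * sin x - p = cos (x - t) - cos (arccos p)"
      using p by (simp add: cos_diff mult.commute)
    also have "\<dots> = 2 * sin ((x - t + arccos p) / 2) * sin ((arccos p - (x - t)) / 2)"
      by (rule cos_diff_cos)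
    also have "(arccos p - (x - t)) / 2 = - ((x - (t + arccos p)) / 2)" by (simp add: field_simps)
    also have "x - t + arccos p = x - (t - arccos p)" by simp
    finally show ?thesis by simp
  qed
  obtain \<alpha> \<sigma> where \<alpha>: "0 \<le> \<alpha>" "\<alpha> < 2 * pi" "\<sigma> \<noteq> 0"
      "\<And>x. sin ((x - (t - arccos p)) / 2) = \<sigma> * sin ((x - \<alpha>) / 2)"
    using half_angle_sine_mod_2pi by blast
  obtain \<beta> \<tau> where \<beta>: "0 \<le> \<beta>" "\<beta> < 2 * pi" "\<tau> \<noteq> 0"
      "\<And>x. sin ((x - (t + arccos p)) / 2) = \<tau> * sin ((x - \<beta>) / 2)"
    using half_angle_sine_mod_2pi by blast
  have \<kappa>: "-2 * \<sigma> * \<tau> \<noteq> 0" using \<alpha> \<beta> by simp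
  show ?thesis
  proof (cases "\<alpha> \<le> \<beta>")
    case True
    show ?thesis by (rule that[OF \<alpha>(1) True \<beta>(2) \<kappa> g]) (simp add: F \<alpha>(4) \<beta>(4))
  next
    case False
    then have "\<beta> \<le> \<alpha>" by simp
    show ?thesis by (rule that[OF \<beta>(1) \<open>\<beta> \<le> \<alpha>\<close> \<alpha>(2) \<kappa> g]) (simp add: F \<alpha>(4) \<beta>(4))
  qed
qed

text \<open>The line through the points of the unit circle with angles \<open>x\<close> and \<open>y\<close>.\<close>

definition line_through :: "real \<Rightarrow> real \<Rightarrow> plane set" where
  "line_through x y = line_of ((x + y) / 2, cos ((y - x) / 2))"

lemma line_through_inter_disk:
  assumes "x < y" "y - x < 2 * pi"
  shows "line_through x y \<inter> unit_disk
      = on_line ((x + y) / 2) (cos ((y - x) / 2)) ` {- sin ((y - x) / 2)..sin ((y - x) / 2)}"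
    and "len (line_through x y \<inter> unit_disk) = 2 * sin ((y - x) / 2)"
proof -
  have "0 \<le> sin ((y - x) / 2)" using assms by (intro sin_ge_zero) auto
  then show "line_through x y \<inter> unit_disk
      = on_line ((x + y) / 2) (cos ((y - x) / 2)) ` {- sin ((y - x) / 2)..sin ((y - x) / 2)}"
    and "len (line_through x y \<inter> unit_disk) = 2 * sin ((y - x) / 2)"
    unfolding line_through_def
    using line_of_inter_disk[of "cos ((y - x) / 2)" "sin ((y - x) / 2)"]
      len_line_of_inter_disk[of "cos ((y - x) / 2)" "sin ((y - x) / 2)"] by auto
qed

lemma affine_function_vanishes_iff:
  fixes c d h :: real
  assumes "0 \<le> h"
  shows "(\<exists>w\<in>{-h..h}. c + d * w = 0) \<longleftrightarrow> (c - d * h) * (c + d * h) \<le> 0"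
proof
  assume "\<exists>w\<in>{-h..h}. c + d * w = 0"
  then obtain w where w: "w \<in> {-h..h}" "c = - (d * w)" by (auto simp: eq_neg_iff_add_eq_0)
  have "w\<^sup>2 \<le> h\<^sup>2" using w by (intro abs_le_square_iff[THEN iffD1]) auto
  then have "d\<^sup>2 * (w\<^sup>2 - h\<^sup>2) \<le> 0" by (simp add: mult_nonneg_nonpos)
  also have "d\<^sup>2 * (w\<^sup>2 - h\<^sup>2) = (c - d * h) * (c + d * h)" unfolding w(2) by algebra
  finally show "(c - d * h) * (c + d * h) \<le> 0" .
next
  assume "(c - d * h) * (c + d * h) \<le> 0"
  then have "c - d * h \<le> 0 \<and> 0 \<le> c + d * h \<or> 0 \<le> c - d * h \<and> c + d * h \<le> 0"
    by (auto simp: mult_le_0_iff)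
  moreover have cont: "continuous_on {-h..h} (\<lambda>w. c + d * w)" by (intro continuous_intros)
  ultimately show "\<exists>w\<in>{-h..h}. c + d * w = 0"
    using IVT'[of "\<lambda>w. c + d * w" "-h" 0 h] IVT2'[of "\<lambda>w. c + d * w" h 0 "-h"] assms
    by (fastforce simp: algebra_simps)
qed

text \<open>Read as parities: the number of ends \<open>\<alpha>\<close>, \<open>\<beta>\<close> between \<open>x\<close> and \<open>y\<close> is odd. The form in terms of ends
  below \<open>x\<close> and ends below \<open>y\<close> makes \<open>x\<close> and \<open>y\<close> enter separately.\<close>

definition separates :: "real \<Rightarrow> real \<Rightarrow> real \<Rightarrow> real \<Rightarrow> bool" where
  "separates \<alpha> \<beta> x y \<longleftrightarrow> ((\<alpha> < x) \<noteq> (\<beta> < x)) \<noteq> ((\<alpha> < y) \<noteq> (\<beta> < y))"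

text \<open>Ends are normalised to \<open>[0, 2 * pi)\<close>. For \<open>x\<close> in \<open>(0, 4)\<close> the half difference then stays between \<open>- pi\<close> and \<open>2 < pi\<close>, so the sine
  changes sign only at \<open>\<alpha>\<close>.\<close>

lemma sin_half_sign_iff:
  assumes "0 < x" "x < 4" "0 \<le> \<alpha>" "\<alpha> < 2 * pi" "x \<noteq> \<alpha>"
  shows "sin ((x - \<alpha>) / 2) < 0 \<longleftrightarrow> \<not> \<alpha> < x" "sin ((x - \<alpha>) / 2) > 0 \<longleftrightarrow> \<alpha> < x"
proof -
  have pos: "sin ((x - \<alpha>) / 2) > 0" if "\<alpha> < x"
    using that assms pi_gt3 by (intro sin_gt_zero) auto
  have neg: "sin ((x - \<alpha>) / 2) < 0" if "x < \<alpha>"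
  proof -
    have "sin ((\<alpha> - x) / 2) > 0" using that assms by (intro sin_gt_zero) auto
    moreover have "(x - \<alpha>) / 2 = - ((\<alpha> - x) / 2)" by (simp only: minus_divide_left minus_diff_eq)
    ultimately show ?thesis by (metis neg_less_0_iff_less sin_minus)
  qed
  show "sin ((x - \<alpha>) / 2) < 0 \<longleftrightarrow> \<not> \<alpha> < x" "sin ((x - \<alpha>) / 2) > 0 \<longleftrightarrow> \<alpha> < x"
    using pos neg assms(5) by (cases "\<alpha> < x"; force)+
qed

text \<open>The equation of the chord's line is an affine function along \<open>line_through x y\<close>, so it has a zero inside the disk
  exactly when its values at the boundary angles \<open>x\<close> and \<open>y\<close> have opposite signs; these signs count the ends
  below \<open>x\<close> and below \<open>y\<close>.\<close>

lemma full_chord_crossing: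
  assumes "full_chord K"
  obtains \<alpha> \<beta> where "\<alpha> \<le> \<beta>"
    "\<And>x y. \<lbrakk>0 < x; x < y; y < 4; x \<noteq> \<alpha>; x \<noteq> \<beta>; y \<noteq> \<alpha>; y \<noteq> \<beta>\<rbrakk>
      \<Longrightarrow> crosses (line_through x y) K \<longleftrightarrow> separates \<alpha> \<beta> x y"
proof -
  obtain g where g: "is_line g" "g \<inter> unit_disk \<noteq> {}" "K = g \<inter> unit_disk"
    using assms by (auto simp: full_chord_def)
  obtain \<alpha> \<beta> \<kappa> t p where \<alpha>\<beta>: "0 \<le> \<alpha>" "\<alpha> \<le> \<beta>" "\<beta> < 2 * pi" "\<kappa> \<noteq> 0"
    and gt: "g = line_of (t, p)"
    and F: "\<And>x. cos t * cos x + sin t * sin x - p = \<kappa> * (sin ((x - \<alpha>) / 2) * sin ((x - \<beta>) / 2))"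
    using line_as_half_angle_sines[OF g(1,2)] by metis
  have "crosses (line_through x y) K \<longleftrightarrow> separates \<alpha> \<beta> x y"
    if xy: "0 < x" "x < y" "y < 4" and ne: "x \<noteq> \<alpha>" "x \<noteq> \<beta>" "y \<noteq> \<alpha>" "y \<noteq> \<beta>" for x y
  proof -
    define \<theta> \<psi> where "\<theta> = (x + y) / 2" and "\<psi> = (y - x) / 2"
    define c d where "c = cos \<psi> * (cos t * cos \<theta> + sin t * sin \<theta>) - p"
      and "d = sin t * cos \<theta> - cos t * sin \<theta>"
    have \<psi>: "0 \<le> sin \<psi>" using xy pi_gt3 unfolding \<psi>_def by (intro sin_ge_zero) auto
    have gw: "on_line \<theta> (cos \<psi>) w \<in> g \<longleftrightarrow> c + d * w = 0" for w
      unfolding gt line_of_def c_def d_def by (auto simp: algebra_simps)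
    have ends: "x = \<theta> - \<psi>" "y = \<theta> + \<psi>" by (simp_all add: \<theta>_def \<psi>_def field_simps)
    have ex: "c - d * sin \<psi> = cos t * cos x + sin t * sin x - p"
      and ey: "c + d * sin \<psi> = cos t * cos y + sin t * sin y - p"
      unfolding ends cos_diff cos_add sin_diff sin_add c_def d_def by algebra+
    note sx = sin_half_sign_iff[of x \<alpha>] sin_half_sign_iff[of x \<beta>]
      and sy = sin_half_sign_iff[of y \<alpha>] sin_half_sign_iff[of y \<beta>]
    have cut: "line_through x y \<inter> unit_disk = on_line \<theta> (cos \<psi>) ` {- sin \<psi>..sin \<psi>}"
      unfolding \<theta>_def \<psi>_def using xy pi_gt3 by (intro line_through_inter_disk) auto
    have "line_through x y \<inter> K \<noteq> {} \<longleftrightarrow> (\<exists>w\<in>{- sin \<psi>..sin \<psi>}. c + d * w = 0)"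
    proof -
      have "line_through x y \<inter> K = (line_through x y \<inter> unit_disk) \<inter> g" using g(3) by blast
      then show ?thesis unfolding cut using gw by auto
    qed
    also have "\<dots> \<longleftrightarrow> (c - d * sin \<psi>) * (c + d * sin \<psi>) \<le> 0"
      by (rule affine_function_vanishes_iff[OF \<psi>])
    also have "(c - d * sin \<psi>) * (c + d * sin \<psi>) = \<kappa>\<^sup>2 * ((sin ((x - \<alpha>) / 2) * sin ((x - \<beta>) / 2))
        * (sin ((y - \<alpha>) / 2) * sin ((y - \<beta>) / 2)))"
      unfolding ex ey F by algebra
    also have "\<dots> \<le> 0 \<longleftrightarrow> separates \<alpha> \<beta> x y"
    proof -
      define a1 a2 b1 b2 where "a1 = sin ((x - \<alpha>) / 2)" and "a2 = sin ((x - \<beta>) / 2)"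
        and "b1 = sin ((y - \<alpha>) / 2)" and "b2 = sin ((y - \<beta>) / 2)"
      have "a1 < 0 \<longleftrightarrow> \<not> \<alpha> < x" "a1 > 0 \<longleftrightarrow> \<alpha> < x" "a2 < 0 \<longleftrightarrow> \<not> \<beta> < x" "a2 > 0 \<longleftrightarrow> \<beta> < x"
        "b1 < 0 \<longleftrightarrow> \<not> \<alpha> < y" "b1 > 0 \<longleftrightarrow> \<alpha> < y" "b2 < 0 \<longleftrightarrow> \<not> \<beta> < y" "b2 > 0 \<longleftrightarrow> \<beta> < y"
        unfolding a1_def a2_def b1_def b2_def using sx sy xy ne \<alpha>\<beta> by auto
      moreover have "\<kappa>\<^sup>2 * (a1 * a2 * (b1 * b2)) \<le> 0 \<longleftrightarrow> a1 * a2 * (b1 * b2) \<le> 0"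
        using \<alpha>\<beta>(4) by (simp add: mult_le_0_iff)
      moreover have "a1 * a2 * (b1 * b2) \<le> 0 \<longleftrightarrow> \<not> (0 < a1 * a2 * (b1 * b2))" by auto
      ultimately show ?thesis
        unfolding a1_def[symmetric] a2_def[symmetric] b1_def[symmetric] b2_def[symmetric] separates_def
        by (simp add: zero_less_mult_iff mult_less_0_iff) blast
    qed
    finally have meet: "line_through x y \<inter> K \<noteq> {} \<longleftrightarrow> separates \<alpha> \<beta> x y" .
    have "g \<noteq> line_through x y"
    proof
      assume "g = line_through x y"
      then have "on_line \<theta> (cos \<psi>) (- sin \<psi>) \<in> g"
        unfolding line_through_def line_of_eq_range \<theta>_def \<psi>_def by blast
      then have "c - d * sin \<psi> = 0" using gw by simp
      then have "sin ((x - \<alpha>) / 2) * sin ((x - \<beta>) / 2) = 0"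
        using ex F[of x] \<alpha>\<beta>(4) by simp
      then show False using sx xy ne \<alpha>\<beta> by auto
    qed
    then show ?thesis using meet g by (auto simp: crosses_def)
  qed
  then show ?thesis using that \<alpha>\<beta>(2) by blast
qed

section \<open>From the essential supremum to single lines\<close>

text \<open>If the bound failed for the line through \<open>x\<close> and \<open>y\<close>, it would fail for all lines in a neighbourhood: no chord end
  lies near \<open>x\<close> or \<open>y\<close>, so the crossing number does not change there, and the length is continuous. A nonempty open set
  of parameters is not a null set.\<close>

lemma buffon_disc_pointwise:
  assumes fin: "finite C"
    and cross: "\<And>K x y. \<lbrakk>K \<in> C; 0 < x; x < y; y < 4; x \<noteq> lo K; x \<noteq> hi K; y \<noteq> lo K; y \<noteq> hi K\<rbrakk>
      \<Longrightarrow> crosses (line_through x y) K \<longleftrightarrow> separates (lo K) (hi K) x y"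
    and disc: "buffon_disc C \<le> ereal m"
    and xy: "0 < x" "x < 1" "3 < y" "y < 4"
    and generic: "x \<notin> lo ` C \<union> hi ` C" "y \<notin> lo ` C \<union> hi ` C"
  shows "\<bar>real (card {K \<in> C. separates (lo K) (hi K) x y})
      - 2 * len (\<Union>C) / (pi * measure lborel unit_disk) * (2 * sin ((y - x) / 2))\<bar> \<le> m"
proof (rule ccontr)
  define \<mu> where "\<mu> = 2 * len (\<Union>C) / (pi * measure lborel unit_disk)"
  define k where "k = real (card {K \<in> C. separates (lo K) (hi K) x y})"
  assume "\<not> ?thesis"
  then have big: "m < \<bar>k - \<mu> * (2 * sin ((y - x) / 2))\<bar>" by (simp add: \<mu>_def k_def)
  define f where "f l = ereal \<bar>real (crossing_number l C) - \<mu> * len (l \<inter> unit_disk)\<bar>" for l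
  have "AE l in line_measure. f l \<le> esssup line_measure f" by (rule esssup_AE)
  moreover have "esssup line_measure f \<le> ereal m"
    using disc unfolding buffon_disc_def f_def[abs_def] \<mu>_def .
  ultimately have "AE l in line_measure. f l \<le> ereal m" by (auto elim: eventually_mono)
  then have "AE q in restrict_space lborel ({0..<pi} \<times> UNIV). f (line_of q) \<le> ereal m"
    unfolding line_measure_def
    by (subst (asm) AE_embed_measure') (simp_all add: space_restrict_space inj_on_line_of)
  moreover have "{0..<pi} \<times> UNIV \<in> sets (borel :: (real \<times> real) measure)"
    by (simp add: borel_prod[symmetric])
  ultimately have ae: "AE q in lborel. q \<in> {0..<pi} \<times> UNIV \<longrightarrow> f (line_of q) \<le> ereal m"
    by (subst (asm) AE_restrict_space_iff) simp_all

  have "open ({0<..<1} - (lo ` C \<union> hi ` C))" "open ({3<..<4} - (lo ` C \<union> hi ` C))"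
    using fin by (auto intro!: open_Diff finite_imp_closed)
  then obtain \<eta>1 \<eta>2 where \<eta>: "\<eta>1 > 0" "ball x \<eta>1 \<subseteq> {0<..<1} - (lo ` C \<union> hi ` C)"
      "\<eta>2 > 0" "ball y \<eta>2 \<subseteq> {3<..<4} - (lo ` C \<union> hi ` C)"
    using xy generic by (metis DiffI greaterThanLessThan_iff openE)

  \<comment> \<open>In the coordinates of the line measure the boundary angles of a line are \<open>\<theta> - arccos p\<close> and \<open>\<theta> + arccos p\<close>.\<close>
  define W where "W = (UNIV \<times> {-1<..<1}) \<inter>
      (\<lambda>(\<theta>, p). (\<theta> - arccos p, \<theta> + arccos p, k - \<mu> * (2 * sin (arccos p)))) -`
        (ball x \<eta>1 \<times> ball y \<eta>2 \<times> {v. m < \<bar>v\<bar>})"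
  have W: "open W"
    unfolding W_def split_def
    by (intro continuous_open_preimage continuous_intros open_Times open_ball open_Collect_less) auto
  have center: "((x + y) / 2, cos ((y - x) / 2)) \<in> W"
  proof -
    have r: "0 < (y - x) / 2" "(y - x) / 2 < pi" using xy pi_gt3 by auto
    have "- 1 < cos ((y - x) / 2)" "cos ((y - x) / 2) < 1"
      using r cos_monotone_0_pi[of 0 "(y - x) / 2"] cos_monotone_0_pi[of "(y - x) / 2" pi] by auto
    moreover have ac: "arccos (cos ((y - x) / 2)) = (y - x) / 2" using r by (intro arccos_cos) auto
    moreover have ends: "(x + y) / 2 - (y - x) / 2 = x" "(x + y) / 2 + (y - x) / 2 = y" by (simp_all add: field_simps)
    ultimately show ?thesis using \<eta>(1,3) big by (simp add: W_def ac ends)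
  qed
  have "\<not> f (line_of q) \<le> ereal m" "q \<in> {0..<pi} \<times> UNIV" if "q \<in> W" for q
  proof -
    obtain \<theta> p where q: "q = (\<theta>, p)" by fastforce
    define x' y' where "x' = \<theta> - arccos p" and "y' = \<theta> + arccos p"
    have p: "-1 < p" "p < 1" and x': "x' \<in> ball x \<eta>1" and y': "y' \<in> ball y \<eta>2"
      and v: "m < \<bar>k - \<mu> * (2 * sin (arccos p))\<bar>"
      using that by (auto simp: W_def q x'_def y'_def)
    have x'01: "0 < x'" "x' < 1" "x' \<notin> lo ` C \<union> hi ` C" and y'34: "3 < y'" "y' < 4" "y' \<notin> lo ` C \<union> hi ` C"
      using subsetD[OF \<eta>(2) x'] subsetD[OF \<eta>(4) y'] by simp_all
    have "(x' + y') / 2 = \<theta>" "(y' - x') / 2 = arccos p" by (simp_all add: x'_def y'_def)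
    then have l: "line_of q = line_through x' y'" using p by (simp add: line_through_def q)
    have same: "(\<gamma> < x') = (\<gamma> < x)" "(\<gamma> < y') = (\<gamma> < y)" if "\<gamma> \<in> lo ` C \<union> hi ` C" for \<gamma>
    proof -
      have nb: "\<gamma> \<notin> ball x \<eta>1" "\<gamma> \<notin> ball y \<eta>2" using \<eta>(2,4) that by blast+
      show "(\<gamma> < x') = (\<gamma> < x)" "(\<gamma> < y') = (\<gamma> < y)"
        using nb x' y' by (auto simp: dist_real_def)
    qed
    have "crosses (line_through x' y') K \<longleftrightarrow> separates (lo K) (hi K) x y" if "K \<in> C" for K
    proof -
      have "crosses (line_through x' y') K \<longleftrightarrow> separates (lo K) (hi K) x' y'"
        using that x'01 y'34 by (intro cross) auto
      also have "\<dots> \<longleftrightarrow> separates (lo K) (hi K) x y"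
        using same[of "lo K"] same[of "hi K"] that by (simp add: separates_def)
      finally show ?thesis .
    qed
    then have "real (crossing_number (line_of q) C) = k"
      unfolding crossing_number_def k_def l by (metis (mono_tags, lifting) Collect_cong)
    moreover have "len (line_of q \<inter> unit_disk) = 2 * sin (arccos p)"
      unfolding l using x'01 y'34 pi_gt3 \<open>(y' - x') / 2 = arccos p\<close>
      by (subst line_through_inter_disk(2)) auto
    ultimately show "\<not> f (line_of q) \<le> ereal m" using v by (simp add: f_def)
    show "q \<in> {0..<pi} \<times> UNIV" using x'01 y'34 pi_gt3 by (auto simp: q x'_def y'_def)
  qed
  then have "AE q in lborel. q \<notin> W" using ae by (auto elim!: eventually_mono)
  then have "W \<in> null_sets lborel" by (subst AE_iff_null_sets) (use W in auto)
  then have "negligible W" by (simp add: negligible_iff_null_sets null_sets_completionI)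
  then show False using W center open_not_negligible by blast
qed

section \<open>Mixed differences of the chord length\<close>

lemma mixed_diff_chord_length:
  "mixed_diff (\<lambda>x y. 2 * sin ((y - x) / 2)) x x' y y'
    = 8 * sin ((y + y' - x - x') / 4) * sin ((x' - x) / 4) * sin ((y' - y) / 4)"
proof -
  define v s t where "v = (y + y' - x - x') / 4" and "s = (x' - x) / 4" and "t = (y' - y) / 4"
  have angles: "(y - x) / 2 = v - t + s" "(y - x') / 2 = v - t - s" "(y' - x) / 2 = v + t + s" "(y' - x') / 2 = v + t - s"
    by (simp_all add: v_def s_def t_def field_simps)
  show ?thesis
    unfolding mixed_diff_def angles v_def[symmetric] s_def[symmetric] t_def[symmetric]
      sin_add sin_diff cos_add cos_diff
    by algebra
qed

lemma half_le_sin: "x / 2 \<le> sin x" if "0 \<le> x" "x \<le> 1" for x :: real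
proof -
  have "sin 0 - 0 / 2 \<le> sin x - x / 2"
  proof (rule DERIV_nonneg_imp_nondecreasing[OF that(1)])
    fix z assume z: "0 \<le> z" "z \<le> x"
    have "cos (pi / 3) \<le> cos z" using z that pi_gt3 by (intro cos_monotone_0_pi_le) auto
    then have "0 \<le> cos z - 1 / 2" by (simp add: cos_60)
    moreover have "((\<lambda>x. sin x - x / 2) has_real_derivative cos z - 1 / 2) (at z)"
      by (auto intro!: derivative_eq_intros)
    ultimately show "\<exists>d. ((\<lambda>x. sin x - x / 2) has_real_derivative d) (at z) \<and> 0 \<le> d" by blast
  qed
  then show ?thesis by simp
qed

lemma half_le_sin_middle: "1 / 2 \<le> sin v" if "1 \<le> v" "v \<le> 2" for v :: real
proof (cases "v \<le> pi / 2")
  case True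
  have "sin (pi / 6) \<le> sin v" using that True pi_less_4 by (intro sin_monotone_2pi_le) auto
  then show ?thesis by (simp add: sin_30)
next
  case False
  have "sin (pi / 6) \<le> sin (pi - v)" using that False pi_less_4 pi_gt3 by (intro sin_monotone_2pi_le) auto
  then show ?thesis by (simp add: sin_30)
qed

text \<open>The three sines are estimated separately: the first argument is an average of half differences \<open>(y - x) / 2\<close> and thus lies
  in \<open>[1, 2]\<close>, where the sine is at least \<open>1 / 2\<close>, and the other two are between \<open>0\<close> and \<open>1 / 4\<close>. This is why
  the arcs \<open>(0, 1)\<close> and \<open>(3, 4)\<close> are used.\<close>

lemma mixed_diff_chord_length_bounds:
  assumes "0 < x" "x < x'" "x' < 1" "3 < y" "y < y'" "y' < 4"
  shows "(x' - x) * (y' - y) / 16 \<le> mixed_diff (\<lambda>x y. 2 * sin ((y - x) / 2)) x x' y y'"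
    and "mixed_diff (\<lambda>x y. 2 * sin ((y - x) / 2)) x x' y y' \<le> (x' - x) * (y' - y) / 2"
proof -
  define v s t where "v = (y + y' - x - x') / 4" and "s = (x' - x) / 4" and "t = (y' - y) / 4"
  have v: "1 / 2 \<le> sin v" unfolding v_def using assms by (intro half_le_sin_middle) auto
  have range: "0 \<le> s" "s \<le> 1" "0 \<le> t" "t \<le> 1" unfolding s_def t_def using assms by auto
  note s = range(1) half_le_sin[OF range(1,2)] sin_x_le_x[OF range(1)]
    and t = range(3) half_le_sin[OF range(3,4)] sin_x_le_x[OF range(3)]
  have "1 / 2 * (s / 2) * (t / 2) \<le> sin v * sin s * sin t"
    using v s t by (intro mult_mono) auto
  moreover have "sin v * sin s * sin t \<le> 1 * s * t"
    using v s t by (intro mult_mono) auto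
  moreover have "s * t = (x' - x) * (y' - y) / 16" by (simp add: s_def t_def)
  ultimately show "(x' - x) * (y' - y) / 16 \<le> mixed_diff (\<lambda>x y. 2 * sin ((y - x) / 2)) x x' y y'"
    and "mixed_diff (\<lambda>x y. 2 * sin ((y - x) / 2)) x x' y y' \<le> (x' - x) * (y' - y) / 2"
    unfolding mixed_diff_chord_length v_def[symmetric] s_def[symmetric] t_def[symmetric] by auto
qed


section \<open>Counting chords between two arcs\<close>

text \<open>Up to an affine change, the indicator of \<open>separates\<close> is a product of a sign depending on \<open>x\<close> and one depending on
  \<open>y\<close>, so its mixed difference vanishes unless both signs change. With only two ends, in
  increasing order, this needs \<open>\<alpha>\<close> in the first interval and \<open>\<beta>\<close> in the second.\<close>

lemma mixed_diff_separates:
  fixes x x' y y' :: real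
  assumes "\<alpha> \<le> \<beta>" "x < x'" "x' < y" "y < y'"
  shows "mixed_diff (\<lambda>x y. of_bool (separates \<alpha> \<beta> x y)) x x' y y'
    = 2 * of_bool (x \<le> \<alpha> \<and> \<alpha> < x' \<and> y \<le> \<beta> \<and> \<beta> < y')"
proof -
  \<comment> \<open>Here \<open>a\<close>, \<open>a'\<close>, \<open>c\<close>, \<open>c'\<close> tell whether \<open>\<alpha>\<close> lies below \<open>x\<close>, \<open>x'\<close>, \<open>y\<close>, \<open>y'\<close>, and \<open>b\<close>, \<open>b'\<close>, \<open>d\<close>, \<open>d'\<close> the same for \<open>\<beta>\<close>.\<close>
  have parity: "of_bool ((a \<noteq> b) \<noteq> (c \<noteq> d)) - of_bool ((a' \<noteq> b') \<noteq> (c \<noteq> d))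
      - of_bool ((a \<noteq> b) \<noteq> (c' \<noteq> d')) + of_bool ((a' \<noteq> b') \<noteq> (c' \<noteq> d'))
    = (2 * of_bool (\<not> a \<and> a' \<and> \<not> d \<and> d') :: real)"
    if "a \<longrightarrow> a'" "a' \<longrightarrow> c" "c \<longrightarrow> c'" "b \<longrightarrow> b'" "b' \<longrightarrow> d" "d \<longrightarrow> d'"
      "b \<longrightarrow> a" "b' \<longrightarrow> a'" "d \<longrightarrow> c" "d' \<longrightarrow> c'" for a a' b b' c c' d d'
  proof (cases d)
    case True
    then show ?thesis using that by (cases b'; cases a; simp; cases b; simp)
  next
    case False
    then have "\<not> b" "\<not> b'" using that by auto
    then show ?thesis using that False by (cases a; cases a'; cases c; simp; cases d'; simp)
  qed
  show ?thesis
    unfolding mixed_diff_def separates_def not_less[symmetric]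
    by (rule parity) (use assms in auto)
qed

lemma mixed_diff_sum: "mixed_diff (\<lambda>x y. \<Sum>k\<in>K. F k x y) x x' y y' = (\<Sum>k\<in>K. mixed_diff (F k) x x' y y')"
  by (simp add: mixed_diff_def sum.distrib sum_subtractf)

lemma mixed_diff_cmult_diff:
  "mixed_diff (\<lambda>x y. c * F x y - G x y) x x' y y' = c * mixed_diff F x x' y y' - mixed_diff G x x' y y'"
  by (simp add: mixed_diff_def algebra_simps)

lemma mixed_diff_count_separated:
  fixes lo hi :: "'k \<Rightarrow> real"
  assumes "finite C" "\<And>K. K \<in> C \<Longrightarrow> lo K \<le> hi K" "x < x'" "x' < y" "y < y'"
  shows "mixed_diff (\<lambda>x y. real (card {K \<in> C. separates (lo K) (hi K) x y})) x x' y y'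
    = 2 * card {K \<in> C. x \<le> lo K \<and> lo K < x' \<and> y \<le> hi K \<and> hi K < y'}"
proof -
  have card: "real (card {K \<in> C. Q K}) = (\<Sum>K\<in>C. of_bool (Q K))" for Q
    using assms(1) by (simp add: Int_def)
  have "mixed_diff (\<lambda>x y. real (card {K \<in> C. separates (lo K) (hi K) x y})) x x' y y'
      = (\<Sum>K\<in>C. mixed_diff (\<lambda>x y. of_bool (separates (lo K) (hi K) x y)) x x' y y')"
    unfolding card mixed_diff_sum ..
  also have "\<dots> = (\<Sum>K\<in>C. 2 * of_bool (x \<le> lo K \<and> lo K < x' \<and> y \<le> hi K \<and> hi K < y'))"
    by (intro sum.cong refl mixed_diff_separates assms)
  also have "\<dots> = 2 * card {K \<in> C. x \<le> lo K \<and> lo K < x' \<and> y \<le> hi K \<and> hi K < y'}"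
    unfolding sum_distrib_left[symmetric] card[symmetric] by simp
  finally show ?thesis .
qed

text \<open>Two grids of mesh \<open>1 / 2 ^ k\<close>, with \<open>2 ^ k\<close> points each, can be moved off finitely many exceptional angles.\<close>

lemma generic_shift:
  fixes X :: "real set"
  assumes "finite X"
  obtains s where "0 < s" "s < 1 / 2 ^ k"
    "\<And>i. i < (2::nat) ^ k \<Longrightarrow> s + i / 2 ^ k \<notin> X" "\<And>i. i < (2::nat) ^ k \<Longrightarrow> 3 + s + i / 2 ^ k \<notin> X"
proof -
  define Y where "Y = (\<Union>i<(2::nat) ^ k. (\<lambda>\<gamma>. \<gamma> - i / 2 ^ k) ` X \<union> (\<lambda>\<gamma>. \<gamma> - 3 - i / 2 ^ k) ` X)"
  have "finite Y" unfolding Y_def using assms by auto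
  moreover have "infinite {0<..<1 / 2 ^ k :: real}" by (simp add: infinite_Ioo)
  ultimately have "infinite ({0<..<1 / 2 ^ k} - Y)" by (rule Diff_infinite_finite)
  then obtain s where s: "s \<in> {0<..<1 / 2 ^ k}" "s \<notin> Y" by (metis Diff_iff finite.emptyI all_not_in_conv)
  have "s + i / 2 ^ k \<notin> X" "3 + s + i / 2 ^ k \<notin> X" if "i < 2 ^ k" for i :: nat
  proof -
    have "s + i / 2 ^ k - i / 2 ^ k \<in> Y" if "s + i / 2 ^ k \<in> X"
      using \<open>i < 2 ^ k\<close> that unfolding Y_def by blast
    then show "s + i / 2 ^ k \<notin> X" using s by auto
    have "3 + s + i / 2 ^ k - 3 - i / 2 ^ k \<in> Y" if "3 + s + i / 2 ^ k \<in> X"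
      using \<open>i < 2 ^ k\<close> that unfolding Y_def by blast
    then show "3 + s + i / 2 ^ k \<notin> X" using s by auto
  qed
  then show ?thesis using that s by auto
qed

text \<open>The Riesz product bound applied on a grid in \<open>(0, 1) \<times> (3, 4)\<close>. A chord with one end in each arc becomes a point of the
  grid, namely the indices just below its ends. The discrepancy bound itself, used on the whole grid, shows that there are
  at most \<open>2 ^ n / 2\<close> such chords, however many chords there are in total.\<close>

proposition separation_count_discrepancy:
  fixes lo hi :: "'k \<Rightarrow> real" and \<mu> m :: real
  assumes fin: "finite C" and lohi: "\<And>K. K \<in> C \<Longrightarrow> lo K \<le> hi K"
    and bound: "\<And>x y. \<lbrakk>0 < x; x < 1; 3 < y; y < 4; x \<notin> lo ` C \<union> hi ` C; y \<notin> lo ` C \<union> hi ` C\<rbrakk>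
      \<Longrightarrow> \<bar>real (card {K \<in> C. separates (lo K) (hi K) x y}) - \<mu> * (2 * sin ((y - x) / 2))\<bar> \<le> m"
    and \<mu>: "0 \<le> \<mu>" "8 * m \<le> \<mu>" "\<mu> \<le> 2 ^ n"
  shows "real (Suc n) * \<mu> \<le> 2 ^ 17 * 2 ^ n * m"
proof -
  define w where "w = (2::real) ^ Suc n"
  have w: "w > 0" by (simp add: w_def)
  have "finite (lo ` C \<union> hi ` C)" using fin by simp
  then obtain s where s: "0 < s" "s < 1 / w"
    and gen: "\<And>i. i < (2::nat) ^ Suc n \<Longrightarrow> s + i / w \<notin> lo ` C \<union> hi ` C"
      "\<And>i. i < (2::nat) ^ Suc n \<Longrightarrow> 3 + s + i / w \<notin> lo ` C \<union> hi ` C"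
    unfolding w_def using generic_shift[of "lo ` C \<union> hi ` C" "Suc n"] by blast
  define X where "X i = s + real i / w" for i :: nat
  define Y where "Y j = 3 + s + real j / w" for j :: nat
  have X: "0 < X i" "X i < 1" "3 < Y i" "Y i < 4" if "i < 2 ^ Suc n" for i
  proof -
    have "real i + 1 \<le> w" unfolding w_def using that
      by (metis Suc_eq_plus1 Suc_leI of_nat_Suc of_nat_le_iff of_nat_numeral of_nat_power add.commute)
    then have "real i / w + 1 / w \<le> 1" using w by (simp add: divide_simps)
    moreover have "0 \<le> real i / w" using w by simp
    ultimately show "0 < X i" "X i < 1" "3 < Y i" "Y i < 4" using s by (auto simp: X_def Y_def)
  qed
  have mono: "X i < X i'" "Y i < Y i'" if "i < i'" for i i'
    using that w by (auto simp: X_def Y_def divide_strict_right_mono)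
  define F where "F x y = \<mu> * (2 * sin ((y - x) / 2)) - real (card {K \<in> C. separates (lo K) (hi K) x y})" for x y
  define T where "T i j = F (X i) (Y j)" for i j
  define hits where "hits i i' j j' = {K \<in> C. X i \<le> lo K \<and> lo K < X i' \<and> Y j \<le> hi K \<and> hi K < Y j'}" for i i' j j'
  have T: "\<bar>T i j\<bar> \<le> m" if "i < 2 ^ Suc n" "j < 2 ^ Suc n" for i j
    using bound[of "X i" "Y j"] X[OF that(1)] X[OF that(2)] gen(1)[OF that(1)] gen(2)[OF that(2)]
    unfolding T_def F_def by (auto simp: X_def Y_def abs_minus_commute)
  have mixed: "mixed_diff T i i' j j' = \<mu> * mixed_diff (\<lambda>x y. 2 * sin ((y - x) / 2)) (X i) (X i') (Y j) (Y j')
      - 2 * card (hits i i' j j')"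
    and lower: "(X i' - X i) * (Y j' - Y j) / 16 \<le> mixed_diff (\<lambda>x y. 2 * sin ((y - x) / 2)) (X i) (X i') (Y j) (Y j')"
    and upper: "mixed_diff (\<lambda>x y. 2 * sin ((y - x) / 2)) (X i) (X i') (Y j) (Y j') \<le> (X i' - X i) * (Y j' - Y j) / 2"
    if "i < i'" "i' < 2 ^ Suc n" "j < j'" "j' < 2 ^ Suc n" for i i' j j'
  proof -
    have lt: "i < 2 ^ Suc n" "j < 2 ^ Suc n" using that by auto
    note range = X[OF that(2)] X[OF that(4)] X[OF lt(1)] X[OF lt(2)] mono[OF that(1)] mono[OF that(3)]
    have "mixed_diff T i i' j j' = mixed_diff F (X i) (X i') (Y j) (Y j')"
      by (simp add: mixed_diff_def T_def)
    also have "\<dots> = \<mu> * mixed_diff (\<lambda>x y. 2 * sin ((y - x) / 2)) (X i) (X i') (Y j) (Y j')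
        - mixed_diff (\<lambda>x y. real (card {K \<in> C. separates (lo K) (hi K) x y})) (X i) (X i') (Y j) (Y j')"
      unfolding F_def[abs_def] mixed_diff_cmult_diff ..
    also have "mixed_diff (\<lambda>x y. real (card {K \<in> C. separates (lo K) (hi K) x y})) (X i) (X i') (Y j) (Y j')
        = 2 * card (hits i i' j j')"
      unfolding hits_def using range by (intro mixed_diff_count_separated fin lohi) auto
    finally show "mixed_diff T i i' j j' = \<mu> * mixed_diff (\<lambda>x y. 2 * sin ((y - x) / 2)) (X i) (X i') (Y j) (Y j')
      - 2 * card (hits i i' j j')" .
    show "(X i' - X i) * (Y j' - Y j) / 16 \<le> mixed_diff (\<lambda>x y. 2 * sin ((y - x) / 2)) (X i) (X i') (Y j) (Y j')"
      "mixed_diff (\<lambda>x y. 2 * sin ((y - x) / 2)) (X i) (X i') (Y j) (Y j') \<le> (X i' - X i) * (Y j' - Y j) / 2"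
      by (rule mixed_diff_chord_length_bounds; use range in simp)+
  qed

  define e :: nat where "e = 2 ^ Suc n - 1"
  have "(1::nat) \<le> 2 ^ n" by simp
  then have e: "0 < e" "e < 2 ^ Suc n" unfolding e_def power_Suc by linarith+
  define big where "big = hits 0 e 0 e"
  define P where "P = (\<lambda>K. (nat \<lfloor>(lo K - s) * w\<rfloor>, nat \<lfloor>(hi K - 3 - s) * w\<rfloor>)) ` big"
  have fin_big: "finite big" using fin by (simp add: big_def hits_def)
  have "2 * card P \<le> 2 ^ n"
  proof -
    have "2 * real (card big) = \<mu> * mixed_diff (\<lambda>x y. 2 * sin ((y - x) / 2)) (X 0) (X e) (Y 0) (Y e)
        - mixed_diff T 0 e 0 e"
      unfolding big_def using mixed[of 0 e 0 e] e by simp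
    also have "\<dots> \<le> \<mu> * (1 / 2) + 4 * m"
    proof -
      have "(X e - X 0) * (Y e - Y 0) \<le> 1 * 1"
        using X[of 0] X[of e] mono[OF e(1)] e by (intro mult_mono) auto
      then have "mixed_diff (\<lambda>x y. 2 * sin ((y - x) / 2)) (X 0) (X e) (Y 0) (Y e) \<le> 1 / 2"
        using upper[of 0 e 0 e] e by simp
      then have "\<mu> * mixed_diff (\<lambda>x y. 2 * sin ((y - x) / 2)) (X 0) (X e) (Y 0) (Y e) \<le> \<mu> * (1 / 2)"
        using \<mu>(1) by (rule mult_left_mono)
      moreover have "- mixed_diff T 0 e 0 e \<le> 4 * m"
        using T[of 0 0] T[of e 0] T[of 0 e] T[of e e] e unfolding mixed_diff_def by auto
      ultimately show ?thesis by simp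
    qed
    also have "\<dots> \<le> 2 ^ n" using \<mu> by linarith
    finally have "real (2 * card big) \<le> real (2 ^ n)" by simp
    then have "2 * card big \<le> 2 ^ n" by (simp only: of_nat_le_iff)
    moreover have "card P \<le> card big" unfolding P_def by (rule card_image_le[OF fin_big])
    ultimately show ?thesis by linarith
  qed
  moreover have no_hits: "hits i i' j j' = {}"
    if "i < i'" "i' < 2 ^ Suc n" "j < j'" "j' < 2 ^ Suc n" and free: "P \<inter> {i..<i'} \<times> {j..<j'} = {}" for i i' j j'
  proof (rule equals0I)
    fix K assume K: "K \<in> hits i i' j j'"
    have idx: "k \<le> nat \<lfloor>z * w\<rfloor> \<and> nat \<lfloor>z * w\<rfloor> < k'" if "real k / w \<le> z" "z < real k' / w" for k k' z
    proof
      have "real k \<le> z * w" "z * w < real k'" using that w by (simp_all add: pos_divide_le_eq pos_less_divide_eq)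
      then show "k \<le> nat \<lfloor>z * w\<rfloor>" "nat \<lfloor>z * w\<rfloor> < k'" by (simp_all add: le_nat_floor) linarith
    qed
    have "i' \<le> e" "j' \<le> e" using that unfolding e_def by linarith+
    then have "X 0 \<le> X i" "X i' \<le> X e" "Y 0 \<le> Y j" "Y j' \<le> Y e"
      using w by (auto simp: X_def Y_def intro!: divide_right_mono)
    then have "K \<in> big" using K unfolding big_def hits_def by auto
    moreover have "nat \<lfloor>(lo K - s) * w\<rfloor> \<in> {i..<i'}" "nat \<lfloor>(hi K - 3 - s) * w\<rfloor> \<in> {j..<j'}"
      using K idx[of i "lo K - s" i'] idx[of j "hi K - 3 - s" j'] by (auto simp: hits_def X_def Y_def)
    ultimately show False using free unfolding P_def by blast
  qed
  ultimately interpret near_uniform_grid T P n "\<mu> / (16 * w\<^sup>2)" "\<mu> / (2 * w\<^sup>2)"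
  proof unfold_locales
    fix i i' j j' :: nat
    assume ij: "i < i'" "i' < 2 ^ Suc n" "j < j'" "j' < 2 ^ Suc n" "P \<inter> {i..<i'} \<times> {j..<j'} = {}"
    have D: "mixed_diff T i i' j j' = \<mu> * mixed_diff (\<lambda>x y. 2 * sin ((y - x) / 2)) (X i) (X i') (Y j) (Y j')"
      using mixed[OF ij(1-4)] no_hits[OF ij] by simp
    have step: "X i' - X i = real (i' - i) / w" "Y j' - Y j = real (j' - j) / w"
      using ij by (auto simp: X_def Y_def of_nat_diff diff_divide_distrib)
    have "\<mu> * ((X i' - X i) * (Y j' - Y j) / 16) \<le> mixed_diff T i i' j j'"
      "mixed_diff T i i' j j' \<le> \<mu> * ((X i' - X i) * (Y j' - Y j) / 2)"
      unfolding D by (intro mult_left_mono lower[OF ij(1-4)] upper[OF ij(1-4)] \<mu>(1))+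
    then show "\<mu> / (16 * w\<^sup>2) * real (i' - i) * real (j' - j) \<le> mixed_diff T i i' j j'"
      "mixed_diff T i i' j j' \<le> \<mu> / (2 * w\<^sup>2) * real (i' - i) * real (j' - j)"
      unfolding step by (simp_all add: power2_eq_square)
  qed (use fin_big \<mu> in \<open>auto simp: P_def\<close>)
  \<comment> \<open>Here \<open>B = 8 * A\<close>, so \<open>\<gamma> * A / 2 - 2 * \<gamma>\<^sup>2 * B\<close> is \<open>A / 256\<close> for \<open>\<gamma> = 1 / 64\<close>.\<close>
  have "real (Suc n) * 2 ^ n * (1 / 64 * (\<mu> / (16 * w\<^sup>2)) / 2 - 2 * (1 / 64)\<^sup>2 * (\<mu> / (2 * w\<^sup>2))) \<le> 8 * m"
    by (rule sup_norm_lower_bound[OF _ _ T]) auto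
  also have "1 / 64 * (\<mu> / (16 * w\<^sup>2)) / 2 - 2 * (1 / 64)\<^sup>2 * (\<mu> / (2 * w\<^sup>2)) = \<mu> / (2 ^ 12 * w\<^sup>2)"
    by (simp add: power2_eq_square)
  also have "w\<^sup>2 = 4 * (2 ^ n * 2 ^ n)" by (simp add: w_def power2_eq_square)
  finally show ?thesis by (simp add: divide_simps mult_ac)
qed


section \<open>The logarithmic lower bound\<close>

theorem theorem1p2:
  "\<exists>c::real. c > 0 \<and> (\<exists>L\<^sub>0::real. \<forall>C :: plane set set.
     finite C \<longrightarrow> (\<forall>K\<in>C. full_chord K) \<longrightarrow> len (\<Union>C) \<ge> L\<^sub>0 \<longrightarrow>
       buffon_disc C \<ge> ereal (c * ln (len (\<Union>C))))"
proof -
  define \<kappa> where "\<kappa> = 2 / (pi * measure lborel unit_disk)"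
  have \<kappa>: "\<kappa> > 0" unfolding \<kappa>_def using content_cball_pos[of 1 "0 :: plane"] by simp
  \<comment> \<open>With the first entry the Riesz product estimate contradicts a smaller discrepancy; the second keeps the assumed discrepancy below \<open>\<mu> / 8\<close>.\<close>
  define c where "c = min (1 / 2 ^ 20) (\<kappa> / 8)"
  have c: "c > 0" "c \<le> 1 / 2 ^ 20" "8 * c \<le> \<kappa>" using \<kappa> by (auto simp: c_def)
  \<comment> \<open>The last entry absorbs the constant factor \<open>\<kappa>\<close> between \<open>\<mu>\<close> and \<open>L(S)\<close> into half of the logarithm.\<close>
  define L\<^sub>0 where "L\<^sub>0 = max 2 (max (1 / \<kappa>) (1 / \<kappa>\<^sup>2))"
  have "ereal (c * ln (len (\<Union>C))) \<le> buffon_disc C"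
    if fin: "finite C" and chords: "\<forall>K\<in>C. full_chord K" and L: "L\<^sub>0 \<le> len (\<Union>C)" for C :: "plane set set"
  proof (rule ccontr)
    define L m where "L = len (\<Union>C)" and "m = c * ln L"
    assume "\<not> ?thesis"
    then have disc: "buffon_disc C \<le> ereal m" by (simp add: L_def m_def)
    have L2: "L \<ge> 2" "1 / \<kappa> \<le> L" "1 / \<kappa>\<^sup>2 \<le> L" using L by (auto simp: L\<^sub>0_def L_def)
    define \<mu> where "\<mu> = \<kappa> * L"
    have \<mu>: "1 \<le> \<mu>" using L2(2) \<kappa> by (simp add: \<mu>_def pos_divide_le_eq mult.commute)
    have ln_pos: "0 < ln L" using L2 by simp
    have m_le: "8 * m \<le> \<mu>"
    proof -
      have "8 * c * ln L \<le> \<kappa> * L"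
        using c \<kappa> ln_pos L2 ln_le_minus_one[of L] by (intro mult_mono) auto
      then show ?thesis by (simp add: m_def \<mu>_def)
    qed
    have "\<forall>K\<in>C. \<exists>\<alpha> \<beta>. \<alpha> \<le> \<beta> \<and> (\<forall>x y. 0 < x \<longrightarrow> x < y \<longrightarrow> y < 4 \<longrightarrow> x \<noteq> \<alpha> \<longrightarrow> x \<noteq> \<beta> \<longrightarrow> y \<noteq> \<alpha> \<longrightarrow> y \<noteq> \<beta>
        \<longrightarrow> (crosses (line_through x y) K \<longleftrightarrow> separates \<alpha> \<beta> x y))"
    proof
      fix K assume "K \<in> C"
      then have "full_chord K" using chords by blast
      then show "\<exists>\<alpha> \<beta>. \<alpha> \<le> \<beta> \<and> (\<forall>x y. 0 < x \<longrightarrow> x < y \<longrightarrow> y < 4 \<longrightarrow> x \<noteq> \<alpha> \<longrightarrow> x \<noteq> \<beta> \<longrightarrow> y \<noteq> \<alpha> \<longrightarrow> y \<noteq> \<beta>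
          \<longrightarrow> (crosses (line_through x y) K \<longleftrightarrow> separates \<alpha> \<beta> x y))"
        by (rule full_chord_crossing) blast
    qed
    then obtain lo hi where lohi: "\<And>K. K \<in> C \<Longrightarrow> lo K \<le> hi K"
      and cross: "\<And>K x y. \<lbrakk>K \<in> C; 0 < x; x < y; y < 4; x \<noteq> lo K; x \<noteq> hi K; y \<noteq> lo K; y \<noteq> hi K\<rbrakk>
        \<Longrightarrow> crosses (line_through x y) K \<longleftrightarrow> separates (lo K) (hi K) x y"
      by metis
    have bound: "\<bar>real (card {K \<in> C. separates (lo K) (hi K) x y}) - \<mu> * (2 * sin ((y - x) / 2))\<bar> \<le> m"
      if "0 < x" "x < 1" "3 < y" "y < 4" "x \<notin> lo ` C \<union> hi ` C" "y \<notin> lo ` C \<union> hi ` C" for x y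
      using buffon_disc_pointwise[OF fin cross disc that] by (simp add: \<mu>_def \<kappa>_def L_def)
    define n where "n = (LEAST n. \<mu> \<le> 2 ^ n)"
    have "\<exists>n. \<mu> \<le> 2 ^ n" using real_arch_pow[of 2 \<mu>] by (auto intro: less_imp_le)
    then have n: "\<mu> \<le> 2 ^ n" unfolding n_def by (rule LeastI_ex)
    have n': "2 ^ n \<le> 2 * \<mu>"
    proof (cases n)
      case (Suc k)
      then have "\<not> \<mu> \<le> 2 ^ k" unfolding n_def using not_less_Least lessI by metis
      then show ?thesis using Suc by simp
    qed (use \<mu> in simp)
    have "0 \<le> m" using c ln_pos by (simp add: m_def)
    have "real (Suc n) * \<mu> \<le> 2 ^ 17 * 2 ^ n * m"
      using \<mu> by (intro separation_count_discrepancy[OF fin lohi bound _ m_le n]) auto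
    also have "\<dots> \<le> 2 ^ 17 * (2 * \<mu>) * m"
      using n' \<open>0 \<le> m\<close> by (intro mult_right_mono mult_left_mono) auto
    finally have "real (Suc n) * \<mu> \<le> (2 ^ 18 * m) * \<mu>" by (simp add: mult_ac)
    then have "real (Suc n) \<le> 2 ^ 18 * m" using \<mu> by simp
    moreover have "ln \<mu> \<le> real n"
    proof -
      have "ln \<mu> \<le> ln (2 ^ n)" using n \<mu> by (subst ln_le_cancel_iff) auto
      also have "\<dots> = real n * ln 2" by (simp add: ln_realpow)
      also have "\<dots> \<le> real n * 1" using ln_le_minus_one[of 2] by (intro mult_left_mono) auto
      finally show ?thesis by simp
    qed
    moreover have "ln L / 2 \<le> ln \<mu>"
    proof -
      have "ln (1 / \<kappa>\<^sup>2) \<le> ln L" using L2 \<kappa> by (subst ln_le_cancel_iff) auto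
      then have "- (2 * ln \<kappa>) \<le> ln L" using \<kappa> by (simp add: ln_div ln_realpow)
      moreover have "ln \<mu> = ln \<kappa> + ln L" using \<kappa> L2 by (simp add: \<mu>_def ln_mult)
      ultimately show ?thesis by simp
    qed
    moreover have "2 ^ 18 * m \<le> ln L / 4"
      using mult_right_mono[OF c(2), of "ln L"] ln_pos by (simp add: m_def)
    ultimately show False using ln_pos by linarith
  qed
  then show ?thesis using c(1) by blast
qed

end
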